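(* Let $n\ge 1$ be an integer and let $\Phi$ be the $n$-dimensional Matérn cluster process with parent intensity $\lambda_{\mathrm p}>0$, daughter intensity $\lambda_{\mathrm d}>0$ and cluster radius $r_{\mathrm d}>0$, and let $F_{R_{\mathrm C}}(r)=\mathbb P(R_{\mathrm C}\le r)$ with $R_{\mathrm C}=\min_{\mathbf z\in\Phi}\|\mathbf z\|$. Then for every $r>0$, $\underline{F_{R_{\mathrm C}}}(r)\le F_{R_{\mathrm C}}(r)\le \overline{F_{R_{\mathrm C}}}(r)$, where \[ \overline{F_{R_{\mathrm C}}}(r)=1-\exp\Big[-v_n\lambda_{\mathrm p}\Big((r+r_{\mathrm d})^n-|r-r_{\mathrm d}|^n e^{-\lambda_{\mathrm d}v_n\beta(r)^n}-n!\sum_{k=0}^{n-1}\frac{(-1)^{n-k-1}}{k!}\big(\lambda_{\mathrm d}2^{n-1}\beta(r)^{n-1}\big)^{k-n}\Big((r+r_{\mathrm d})^k-|r-r_{\mathrm d}|^k e^{-2^n\lambda_{\mathrm d}\beta(r)^n}\Big)\Big)\Big], \] \[ \underline{F_{R_{\mathrm C}}}(r)=1-\exp\Big[-v_n\lambda_{\mathrm p}\Big((r+r_{\mathrm d})^n-|r-r_{\mathrm d}|^n e^{-\lambda_{\mathrm d}v_n\beta(r)^n}-(r+r_{\mathrm d})^n\sum_{i=0}^{n-1}\binom{n-1}{i}(-1)^i2^{i+1}\big(\lambda_{\mathrm d}v_n(r+r_{\mathrm d})^n\big)^{-(i+1)/n}\gamma\Big(\tfrac{i+1}{n},\lambda_{\mathrm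 d}v_n\beta(r)^n\Big)\Big)\Big], \] and $\gamma(s,x)=\int_0^x t^{s-1}e^{-t}\,\mathrm dt$ is the lower incomplete gamma function.
   Context: The $n$-dimensional Matérn cluster process: $\Phi_{\mathrm p}=\{\mathbf x_i\}$ is a homogeneous Poisson point process in $\mathbb R^n$ of intensity $\lambda_{\mathrm p}$; each parent $\mathbf x_i$ receives an independent daughter process $\Phi_{\mathrm d}^{(i)}$, a homogeneous Poisson point process of intensity $\lambda_{\mathrm d}$ restricted to the ball $\mathcal B(\mathrm o,r_{\mathrm d})$ centered at the origin, independent of $\Phi_{\mathrm p}$; $\Phi=\bigcup_i(\mathbf x_i+\Phi_{\mathrm d}^{(i)})$. $v_n$ is the volume of the unit ball in $\mathbb R^n$ and $\beta(r)=\min\{r,r_{\mathrm d}\}$. *)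

theory Defs
  imports "HOL-Probability.Probability"
begin

text \<open>Points of R^n are modelled as elements of real^'n, so n = CARD('n) \<ge> 1.\<close>

definition unit_ball_volume :: "('n::finite) itself \<Rightarrow> real" where
  "unit_ball_volume _ = measure lborel (ball (0::real^'n) 1)"

definition lower_inc_gamma :: "real \<Rightarrow> real \<Rightarrow> real" where
  "lower_inc_gamma s x = integral {0..x} (\<lambda>t. t powr (s - 1) * exp (- t))"

definition pcount :: "('w \<Rightarrow> 'p set) \<Rightarrow> 'p set \<Rightarrow> 'w \<Rightarrow> nat" where
  "pcount P A w = card (P w \<inter> A)"

definition pp_sigma :: "'w measure \<Rightarrow> ('w \<Rightarrow> ('a::euclidean_space) set) \<Rightarrow> 'w set set" where
  "pp_sigma M P = sigma_sets (space M)
     {{w \<in> space M. pcount P A w = k} | A k. A \<in> sets borel \<and> bounded A}"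

definition poisson_pp ::
  "'w measure \<Rightarrow> ('w \<Rightarrow> ('a::euclidean_space) set) \<Rightarrow> real \<Rightarrow> 'a set \<Rightarrow> bool" where
  "poisson_pp M P lam S \<longleftrightarrow>
     (\<forall>w\<in>space M. P w \<subseteq> S) \<and>
     (\<forall>w\<in>space M. \<forall>A. bounded A \<longrightarrow> finite (P w \<inter> A)) \<and>
     (\<forall>A k. A \<in> sets borel \<and> bounded A \<longrightarrow>
        {w \<in> space M. pcount P A w = k} \<in> sets M \<and>
        measure M {w \<in> space M. pcount P A w = k} =
          exp (- (lam * measure lborel (A \<inter> S))) * (lam * measure lborel (A \<inter> S)) ^ k / fact k) \<and>
     (\<forall>(J::nat set) A. finite J \<and> (\<forall>j\<in>J. A j \<in> sets borel \<and> bounded (A j)) \<and> disjoint_family_on A J \<longrightarrow>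
        prob_space.indep_vars M (\<lambda>_. count_space UNIV) (\<lambda>j. pcount P (A j)) J)"

text \<open>The n-dimensional Matern cluster process.  The parent process is given by an
  injective enumeration X 0, X 1, ... of its points (measurable random vectors);
  D i is the daughter process attached to parent X i.  The parent process and the
  daughter processes are mutually independent.\<close>
definition matern_cluster ::
  "'w measure \<Rightarrow> (nat \<Rightarrow> 'w \<Rightarrow> real^'n) \<Rightarrow> (nat \<Rightarrow> 'w \<Rightarrow> (real^'n) set)
     \<Rightarrow> real \<Rightarrow> real \<Rightarrow> real \<Rightarrow> bool" where
  "matern_cluster M X D lp ld rd \<longleftrightarrow>
     prob_space M \<and>
     (\<forall>i. X i \<in> borel_measurable M) \<and>
     (\<forall>w\<in>space M. inj (\<lambda>i. X i w)) \<and>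
     poisson_pp M (\<lambda>w. range (\<lambda>i. X i w)) lp UNIV \<and>
     (\<forall>i. poisson_pp M (D i) ld (ball 0 rd)) \<and>
     prob_space.indep_sets M
        (\<lambda>j. case j of
               None \<Rightarrow> sigma_sets (space M) (\<Union>i. {X i -` B \<inter> space M | B. B \<in> sets borel})
             | Some i \<Rightarrow> pp_sigma M (D i)) UNIV"

definition cluster_points ::
  "(nat \<Rightarrow> 'w \<Rightarrow> real^'n) \<Rightarrow> (nat \<Rightarrow> 'w \<Rightarrow> (real^'n) set) \<Rightarrow> 'w \<Rightarrow> (real^'n) set" where
  "cluster_points X D w = (\<Union>i. (\<lambda>z. X i w + z) ` D i w)"

text \<open>Contact distance R_C = min_{z \<in> Phi} |z| (infimum, which is attained a.s.).\<close>
definition contact_dist ::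
  "(nat \<Rightarrow> 'w \<Rightarrow> real^'n) \<Rightarrow> (nat \<Rightarrow> 'w \<Rightarrow> (real^'n) set) \<Rightarrow> 'w \<Rightarrow> real" where
  "contact_dist X D w = (INF z \<in> cluster_points X D w. norm z)"

end

theory Submission
  imports Defs
begin

text \<open>Given the parents, the daughter processes are independent, and a parent at \<open>x\<close> contributes no
  point to the ball of radius \<open>r\<close> about the origin with probability
  \<open>g x = exp (- ld * lens_vol r rd x)\<close>, where the lens is the intersection of balls of radii \<open>r\<close> and
  \<open>rd\<close> with centres at distance \<open>norm x\<close>. The product functional of the Poisson process of parents
  then gives \<open>1 - F = exp (- lp * \<integral> (1 - g))\<close>. For \<open>norm x < \<bar>r - rd\<bar>\<close> the lens is the smaller ball.
  Otherwise it contains a ball of diameter \<open>r + rd - norm x\<close> and lies in a box with one side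
  \<open>r + rd - norm x\<close> and all others \<open>2 \<beta>\<close>. In polar coordinates these two estimates turn into
  one-dimensional integrals with exactly the closed forms in the theorem.\<close>

section \<open>Volume of the lens\<close>

text \<open>Two obstacles shape the probabilistic half. A daughter process is observed only through
  its counts in fixed Borel sets, while the ball it has to avoid is centred at \<open>- X i\<close>,
  a random point. Parents and daughters are therefore put on separate coordinates of a product
  space, and the moving ball is traced by countably many fixed balls with centres in a dense
  sequence. Moreover \<open>contact_dist\<close> is an infimum, and
  \<open>contact_dist \<le> r\<close> matches hitting the closed ball because nonempty
  \<open>cluster_points\<close> are locally finite. A larger lens lowers \<open>g\<close> and raises
  \<open>F\<close>: the box yields the upper bound on \<open>F\<close>, the inscribed ball the lower
  one. The identity \<open>r + rd - \<bar>r - rd\<bar> = 2 * \<beta>\<close> explains the closed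
  forms at the inner radius: there the box is a cube of side \<open>2 * \<beta>\<close> and the
  inscribed ball has radius \<open>\<beta>\<close>.\<close>

lemma nn_integral_lborel_translation:
  fixes f :: "'a::euclidean_space \<Rightarrow> ennreal"
  assumes [measurable]: "f \<in> borel_measurable borel"
  shows "(\<integral>\<^sup>+x. f (c + x) \<partial>lborel) = (\<integral>\<^sup>+x. f x \<partial>lborel)"
proof -
  have "(\<integral>\<^sup>+x. f x \<partial>distr lborel borel ((+) c)) = (\<integral>\<^sup>+x. f (c + x) \<partial>lborel)"
    by (rule nn_integral_distr) auto
  then show ?thesis by (simp add: lborel_distr_plus)
qed

text \<open>Averaging the translates of \<open>A\<close> over the unit ball, and exchanging the order of
  integration, identifies the image measure with Lebesgue measure up to the ratio of the two
  masses of the ball, which is 1. The library proves this only for \<open>real^'n\<close> with a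
  well-ordered index type.\<close>
lemma distr_lborel_orthogonal_transformation:
  fixes f :: "'a::euclidean_space \<Rightarrow> 'a"
  assumes f: "orthogonal_transformation f"
  shows "distr lborel borel f = lborel"
proof -
  define g where "g = inv f"
  have lin: "linear f" and nf: "\<And>x. norm (f x) = norm x"
    using f by (auto simp: orthogonal_transformation)
  have fg: "f (g x) = x" for x
    using f by (simp add: g_def orthogonal_transformation_surj surj_f_inv_f)
  have [measurable]: "f \<in> borel_measurable borel"
    by (intro borel_measurable_continuous_onI linear_continuous_on lin
      linear_conv_bounded_linear[THEN iffD1])
  define B where "B = ball (0::'a) 1"
  have [measurable]: "B \<in> sets borel" by (simp add: B_def)
  have B: "emeasure lborel B \<noteq> 0" "emeasure lborel B \<noteq> \<infinity>"
    using content_ball_pos[of 1 "0::'a"] emeasure_lborel_ball_finite[of "0::'a" 1]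
    by (auto simp: measure_def B_def)
  show ?thesis
  proof (rule measure_eqI)
    fix A assume "A \<in> sets (distr lborel borel f)"
    then have [measurable]: "A \<in> sets borel" by simp
    have "emeasure (distr lborel borel f) A * emeasure lborel B
        = (\<integral>\<^sup>+y. indicator B y * (\<integral>\<^sup>+x. indicator A (f x) \<partial>lborel) \<partial>lborel)"
    proof -
      have "emeasure (distr lborel borel f) A = (\<integral>\<^sup>+x. indicator A x \<partial>distr lborel borel f)"
        by simp
      also have "\<dots> = (\<integral>\<^sup>+x. indicator A (f x) \<partial>lborel)"
        by (rule nn_integral_distr) auto
      finally show ?thesis 
        by (subst nn_integral_multc) (auto simp: mult.commute)
    qed
    also have "\<dots> = (\<integral>\<^sup>+y. (\<integral>\<^sup>+x. indicator B y * indicator A (f x + y) \<partial>lborel) \<partial>lborel)"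
    proof (rule nn_integral_cong)
      fix y
      have "(\<integral>\<^sup>+x. indicator A (f x) \<partial>lborel) = (\<integral>\<^sup>+x. indicator A (f (g y + x)) \<partial>lborel)"
        by (rule nn_integral_lborel_translation[symmetric]) measurable
      also have "\<dots> = (\<integral>\<^sup>+x. indicator A (f x + y) \<partial>lborel)"
        by (simp add: linear_add[OF lin] fg add.commute)
      finally show "indicator B y * (\<integral>\<^sup>+x. indicator A (f x) \<partial>lborel)
        = (\<integral>\<^sup>+x. indicator B y * indicator A (f x + y) \<partial>lborel)"
        by (simp add: nn_integral_cmult)
    qed
    also have "\<dots> = (\<integral>\<^sup>+x. (\<integral>\<^sup>+y. indicator B y * indicator A (f x + y) \<partial>lborel) \<partial>lborel)"
      by (rule lborel_pair.Fubini') measurable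
    also have "\<dots> = (\<integral>\<^sup>+x. (\<integral>\<^sup>+y. indicator B (y - f x) * indicator A y \<partial>lborel) \<partial>lborel)"
    proof (rule nn_integral_cong)
      fix x
      show "(\<integral>\<^sup>+y. indicator B y * indicator A (f x + y) \<partial>lborel)
         = (\<integral>\<^sup>+y. indicator B (y - f x) * indicator A y \<partial>lborel)"
        using nn_integral_lborel_translation[of "\<lambda>y. indicator B (y - f x) * indicator A y" "f x"]
        by simp
    qed
    also have "\<dots> = (\<integral>\<^sup>+y. (\<integral>\<^sup>+x. indicator B (y - f x) * indicator A y \<partial>lborel) \<partial>lborel)"
      by (rule lborel_pair.Fubini') measurable
    also have "\<dots> = (\<integral>\<^sup>+y. emeasure lborel B * indicator A y \<partial>lborel)"
    proof (rule nn_integral_cong)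
      fix y
      \<comment> \<open>Since \<open>f\<close> is an isometry with \<open>f (g y) = y\<close>, the
        preimage of the unit ball about \<open>y\<close> is the unit ball about \<open>g y\<close>,
        whose mass does not depend on \<open>y\<close>.\<close>
      have "indicator B (y - f x) = (indicator B (x - g y) :: ennreal)" for x
      proof -
        have "norm (x - g y) = norm (f (x - g y))" by (simp add: nf)
        also have "\<dots> = norm (f x - y)" by (simp add: linear_diff[OF lin] fg)
        finally show ?thesis by (simp add: indicator_def B_def norm_minus_commute)
      qed
      then have "(\<integral>\<^sup>+x. indicator B (y - f x) \<partial>lborel) = (\<integral>\<^sup>+x. indicator B (- g y + x) \<partial>lborel)"
        by simp
      also have "\<dots> = (\<integral>\<^sup>+x. indicator B x \<partial>lborel)"
        by (rule nn_integral_lborel_translation) measurable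
      finally show "(\<integral>\<^sup>+x. indicator B (y - f x) * indicator A y \<partial>lborel)
        = emeasure lborel B * indicator A y"
        by (simp add: nn_integral_multc)
    qed
    also have "\<dots> = emeasure lborel A * emeasure lborel B"
      by (subst nn_integral_cmult) (auto simp: mult.commute)
    finally show "emeasure (distr lborel borel f) A = emeasure lborel A"
      using B by (simp add: mult.commute[of _ "emeasure lborel B"] ennreal_mult_cancel_left)
  qed simp
qed

lemma measure_lborel_ball:
  fixes c :: "real^'n"
  assumes "s \<ge> 0"
  shows "measure lborel (ball c s) = unit_ball_volume TYPE('n) * s ^ CARD('n)"
  using content_ball_conv_unit_ball[OF assms, of c] by (simp add: unit_ball_volume_def)

lemma unit_ball_volume_pos: "unit_ball_volume TYPE('n::finite) > 0"
  unfolding unit_ball_volume_def using content_ball_pos[of 1 "0::real^'n"] by simp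

lemma measure_lborel_cball:
  fixes c :: "real^'n"
  assumes "s \<ge> 0"
  shows "measure lborel (cball c s) = unit_ball_volume TYPE('n) * s ^ CARD('n)"
  using content_cball_conv_ball[of c s] measure_lborel_ball[OF assms, of c] by simp

text \<open>The ball about the origin is translated by \<open>- x\<close> instead of the cluster by
  \<open>x\<close>, so the daughter process stays as given. It is closed because the event is
  \<open>R_C \<le> r\<close>; the other ball is the open support of the daughters.\<close>

definition lens_vol :: "real \<Rightarrow> real \<Rightarrow> real^'n \<Rightarrow> real" where
  "lens_vol r rd x = measure lborel (ball 0 rd \<inter> cball (- x) r)"

text \<open>A linear isometry carries the lens for \<open>x\<close> onto the lens for
  \<open>f x\<close> and preserves Lebesgue measure. The lens volume thus depends on
  \<open>norm x\<close> alone, and \<open>x\<close> can be moved onto a coordinate axis.\<close>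

lemma lens_vol_orthogonal:
  fixes x :: "real^'n" and f :: "real^'n \<Rightarrow> real^'n"
  assumes f: "orthogonal_transformation f"
  shows "lens_vol r rd (f x) = lens_vol r rd x"
proof -
  have lin: "linear f" and nf: "\<And>x. norm (f x) = norm x"
    using f by (auto simp: orthogonal_transformation)
  have [measurable]: "f \<in> borel_measurable borel"
    by (intro borel_measurable_continuous_onI linear_continuous_on lin
      linear_conv_bounded_linear[THEN iffD1])
  have "dist (- f x) (f y) = dist (- x) y" for y
    using nf[of "- x - y"] by (simp add: dist_norm linear_diff[OF lin] linear_neg[OF lin])
  then have "f -` (ball 0 rd \<inter> cball (- f x) r) = ball 0 rd \<inter> cball (- x) r"
    by (auto simp: nf)
  then show ?thesis
    using measure_distr[of f lborel borel "ball 0 rd \<inter> cball (- f x) r"]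
    by (simp add: lens_vol_def distr_lborel_orthogonal_transformation[OF f])
qed

lemma lens_vol_le:
  fixes x :: "real^'n"
  assumes "r > 0" "rd > 0" and x: "\<bar>r - rd\<bar> \<le> norm x" "norm x \<le> r + rd"
  shows "lens_vol r rd x \<le> (r + rd - norm x) * (2 * min r rd) ^ (CARD('n) - 1)"
proof -
  obtain k :: 'n where True by simp
  \<comment> \<open>The sign puts the second centre \<open>- z\<close> on the nonnegative
    \<open>k\<close>-axis. In that direction the lens lies between \<open>norm x - r\<close> and
    \<open>rd\<close>; in every other one both radii bound it, hence \<open>b\<close>.\<close>
  define z :: "real^'n" where "z = - norm x *\<^sub>R axis k 1"
  have "norm z = norm x" by (simp add: z_def)
  then obtain f where f: "orthogonal_transformation f" "f x = z"
    using orthogonal_transformation_exists by metis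
  define b where "b = min r rd"
  define lo hi :: "real^'n" where "lo = (\<chi> i. if i = k then norm x - r else - b)"
    and "hi = (\<chi> i. if i = k then rd else b)"
  have le: "lo $ i \<le> hi $ i" for i using assms by (auto simp: lo_def hi_def b_def)
  have "ball 0 rd \<inter> cball (- z) r \<subseteq> cbox lo hi"
  proof
    fix y assume y: "y \<in> ball 0 rd \<inter> cball (- z) r"
    have 1: "\<bar>y $ i\<bar> \<le> rd" for i
      using y component_le_norm_cart[of y i] by auto
    have 2: "\<bar>y $ i + z $ i\<bar> \<le> r" for i
      using y component_le_norm_cart[of "y + z" i]
      by (auto simp: dist_norm norm_minus_commute add.commute)
    show "y \<in> cbox lo hi"
      unfolding mem_box_cart
    proof
      fix i
      show "lo $ i \<le> y $ i \<and> y $ i \<le> hi $ i"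
        using 1[of i] 2[of i] by (auto simp: lo_def hi_def b_def z_def axis_def)
    qed
  qed
  then have "lens_vol r rd z \<le> measure lborel (cbox lo hi)"
    unfolding lens_vol_def by (intro measure_mono_fmeasurable) (auto simp: fmeasurable_cbox)
  also have "\<dots> = (\<Prod>i\<in>UNIV. hi $ i - lo $ i)"
    using content_cbox_cart[of lo hi] le by (auto simp: interval_ne_empty_cart measure_lborel_cbox_eq)
  also have "\<dots> = (hi $ k - lo $ k) * (\<Prod>i\<in>UNIV - {k}. hi $ i - lo $ i)"
    by (rule prod.remove) auto
  also have "(\<Prod>i\<in>UNIV - {k}. hi $ i - lo $ i) = (\<Prod>i\<in>UNIV - {k}. 2 * b)"
    by (rule prod.cong) (auto simp: hi_def lo_def)
  finally show ?thesis
    using lens_vol_orthogonal[OF f(1), of r rd x] f(2)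
    by (simp add: hi_def lo_def b_def card_Diff_singleton algebra_simps)
qed

text \<open>The line through the two centres meets the lens in a segment of length
  \<open>r + rd - norm x\<close>, and the ball with this segment as diameter touches both spheres
  from inside.\<close>

lemma lens_vol_ge:
  fixes x :: "real^'n"
  assumes "r > 0" "rd > 0" and x: "\<bar>r - rd\<bar> \<le> norm x" "norm x \<le> r + rd"
  shows "unit_ball_volume TYPE('n) * ((r + rd - norm x) / 2) ^ CARD('n) \<le> lens_vol r rd x"
proof -
  define s where "s = norm x"
  define \<rho> where "\<rho> = (r + rd - s) / 2"
  text \<open>The centre of the ball inscribed in the lens; for \<open>x = 0\<close> both radii agree and \<open>t = 0\<close>.\<close>
  define t where "t = (s - r + rd) / 2"
  define c where "c = - (t / s) *\<^sub>R x"
  have nc: "norm c = \<bar>t\<bar>" and ncx: "norm (c + x) = \<bar>s - t\<bar>"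
  proof -
    show "norm c = \<bar>t\<bar>"
      using x by (cases "x = 0") (auto simp: c_def s_def t_def)
    show "norm (c + x) = \<bar>s - t\<bar>"
    proof (cases "x = 0")
      case False
      then have "c + x = ((s - t) / s) *\<^sub>R x"
        by (simp add: c_def s_def diff_divide_distrib scaleR_diff_left)
      then show ?thesis using False by (simp add: s_def)
    qed (use x in \<open>auto simp: c_def s_def t_def\<close>)
  qed
  have "ball c \<rho> \<subseteq> ball 0 rd \<inter> cball (- x) r"
  proof
    fix y assume "y \<in> ball c \<rho>"
    then have y: "norm (y - c) < \<rho>" by (simp add: dist_norm norm_minus_commute)
    have "norm y \<le> norm (y - c) + norm c" by norm
    moreover have "norm (y + x) \<le> norm (y - c) + norm (c + x)"
      using norm_triangle_ineq[of "y - c" "c + x"] by simp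
    \<comment> \<open>The hypothesis \<open>\<bar>r - rd\<bar> \<le> norm x\<close> amounts to
      \<open>0 \<le> t\<close> and \<open>t \<le> s\<close>, and then both inequalities are
      equalities.\<close>
    moreover have "\<bar>t\<bar> + \<rho> \<le> rd" "\<bar>s - t\<bar> + \<rho> \<le> r"
      using x by (auto simp: \<rho>_def t_def s_def[symmetric] abs_if field_simps split: if_splits)
    ultimately show "y \<in> ball 0 rd \<inter> cball (- x) r"
      using y nc ncx by (auto simp: dist_norm norm_minus_commute[of "- x"])
  qed
  then have "measure lborel (ball c \<rho>) \<le> lens_vol r rd x"
    unfolding lens_vol_def
    by (intro measure_mono_fmeasurable fmeasurableI emeasure_bounded_finite bounded_Int) auto
  then show ?thesis
    using x by (simp add: measure_lborel_ball \<rho>_def s_def)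
qed

lemma lens_vol_inside:
  fixes x :: "real^'n"
  assumes "r > 0" "rd > 0" and x: "norm x < \<bar>r - rd\<bar>"
  shows "lens_vol r rd x = unit_ball_volume TYPE('n) * min r rd ^ CARD('n)"
proof (cases "r < rd")
  case True
  have "cball (- x) r \<subseteq> ball 0 rd"
  proof
    fix y assume "y \<in> cball (- x) r"
    then have "norm (y + x) \<le> r" by (simp add: dist_norm norm_minus_commute[of "-x"])
    moreover have "norm y \<le> norm (y + x) + norm x" by norm
    ultimately show "y \<in> ball 0 rd" using x True by auto
  qed
  then have "ball 0 rd \<inter> cball (- x) r = cball (- x) r" by auto
  then show ?thesis using True assms by (simp add: lens_vol_def measure_lborel_cball)
next
  case False
  have "ball 0 rd \<subseteq> cball (- x) r"
  proof
    fix y :: "real^'n" assume "y \<in> ball 0 rd"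
    moreover have "norm (y + x) \<le> norm y + norm x" by norm
    ultimately show "y \<in> cball (- x) r"
      using x False by (auto simp: dist_norm norm_minus_commute[of "-x"])
  qed
  then have "ball 0 rd \<inter> cball (- x) r = ball 0 rd" by auto
  then show ?thesis using False assms by (simp add: lens_vol_def measure_lborel_ball)
qed

section \<open>Radial integration\<close>

text \<open>Polar coordinates are needed only as the law of the norm. For
  \<open>0 \<le> x \<le> R\<close> the half-line \<open>{x<..}\<close> pulls back to a shell whose
  volume, \<open>R ^ CARD('n) - x ^ CARD('n)\<close> times that of the unit ball, is the integral of
  the stated density. Cutting off at \<open>R\<close> keeps these values finite, which the
  comparison on half-lines requires.\<close>

lemma distr_norm_ball:
  assumes "R \<ge> 0"
  shows "distr (density lborel (\<lambda>x. ennreal (indicator (ball (0::real^'n) R) x))) borel norm =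
    density lborel (\<lambda>s. ennreal (indicator {0..R} s *
      (unit_ball_volume TYPE('n) * (real CARD('n) * s ^ (CARD('n) - 1)))))"
    (is "?N1 = ?N2")
proof (rule measure_eqI_lessThan)
  define v where "v = unit_ball_volume TYPE('n)"
  have v: "v > 0" unfolding v_def by (rule unit_ball_volume_pos)
  let ?p = "\<lambda>s. v * (real CARD('n) * s ^ (CARD('n) - 1))"
  have [measurable]: "ball (0::real^'n) R \<in> sets borel" by simp
  have N1: "emeasure ?N1 {x<..} = ennreal (measure lborel (ball (0::real^'n) R \<inter> {y. x < norm y}))" for x
  proof -
    have "emeasure ?N1 {x<..} = (\<integral>\<^sup>+y. ennreal (indicator (ball 0 R) y) * indicator (norm -` {x<..}) y
        \<partial>(lborel :: (real^'n) measure))"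
      using measurable_sets[of norm "borel :: (real^'n) measure" borel "{x<..}"]
      by (subst emeasure_distr, simp, simp, subst emeasure_density) auto
    also have "\<dots> = (\<integral>\<^sup>+y. indicator (ball (0::real^'n) R \<inter> {y. x < norm y}) y \<partial>lborel)"
      by (intro nn_integral_cong) (auto simp: indicator_def)
    also have "\<dots> = emeasure lborel (ball (0::real^'n) R \<inter> {y. x < norm y})"
      by (rule nn_integral_indicator) measurable
    also have "\<dots> = ennreal (measure lborel (ball (0::real^'n) R \<inter> {y. x < norm y}))"
      using emeasure_bounded_finite[of "ball (0::real^'n) R \<inter> {y. x < norm y}"]
      by (intro emeasure_eq_ennreal_measure) (auto simp: bounded_Int)
    finally show ?thesis .
  qed
  have FTC: "(\<integral>\<^sup>+s. ennreal (?p s) * indicator {a..R} s \<partial>lborel) = ennreal (v * (R ^ CARD('n) - a ^ CARD('n)))"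
    if "0 \<le> a" "a \<le> R" for a
  proof -
    have "((\<lambda>s. v * s ^ CARD('n)) has_real_derivative ?p x) (at x)" for x
      by (auto intro!: derivative_eq_intros)
    then show ?thesis
      using nn_integral_FTC_Icc[of ?p a R "\<lambda>s. v * s ^ CARD('n)"] that v
      by (simp add: right_diff_distrib)
  qed
  have N2: "emeasure ?N2 {x<..} = (\<integral>\<^sup>+s. ennreal (?p s) * indicator ({0..R} \<inter> {x<..}) s \<partial>lborel)" for x
    by (subst emeasure_density) (auto simp: v_def indicator_def intro!: nn_integral_cong)
  show "emeasure ?N1 {x<..} < \<infinity>" for x
    by (simp add: N1)
  show "emeasure ?N1 {x<..} = emeasure ?N2 {x<..}" for x
  proof -
    consider "x < 0" | "0 \<le> x" "x \<le> R" | "x > R" "0 \<le> x" using assms by linarith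
    then show ?thesis
    proof cases
      case 1
      then have "ball (0::real^'n) R \<inter> {y. x < norm y} = ball 0 R" "{0..R} \<inter> {x<..} = {0..R}"
        by (auto intro: less_le_trans)
      then show ?thesis using FTC[of 0] assms
        unfolding N1 N2 by (simp add: measure_lborel_ball v_def power_0_left)
    next
      case 2
      have "ball (0::real^'n) R \<inter> {y. x < norm y} = ball 0 R - (ball 0 R \<inter> cball 0 x)"
        by auto
      moreover have "measure lborel (ball (0::real^'n) R \<inter> cball 0 x) = measure lborel (ball (0::real^'n) x)"
      proof (cases "x = R")
        case True
        then have "ball (0::real^'n) R \<inter> cball 0 x = ball 0 x" by auto
        then show ?thesis by simp
      next
        case False
        then have "ball (0::real^'n) R \<inter> cball 0 x = cball 0 x" using 2 by auto
        then show ?thesis using 2 by (simp add: measure_lborel_ball measure_lborel_cball)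
      qed
      ultimately have "measure lborel (ball (0::real^'n) R \<inter> {y. x < norm y}) =
          v * (R ^ CARD('n) - x ^ CARD('n))"
        using 2 assms measure_Diff[of lborel "ball (0::real^'n) R" "ball 0 R \<inter> cball 0 x"]
          emeasure_lborel_ball_finite[of "0::real^'n" R]
        by (simp add: measure_lborel_ball v_def right_diff_distrib less_top)
      moreover have "emeasure ?N2 {x<..} = (\<integral>\<^sup>+s. ennreal (?p s) * indicator {x..R} s \<partial>lborel)"
        unfolding N2 using 2
        by (intro nn_integral_cong_AE) (use AE_lborel_singleton[of x] in \<open>auto simp: indicator_def\<close>)
      ultimately show ?thesis using FTC[of x] 2 by (simp add: N1)
    next
      case 3
      then have "ball (0::real^'n) R \<inter> {y. x < norm y} = {}" "{0..R} \<inter> {x<..} = {}"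
        by auto
      then show ?thesis unfolding N1 N2 by simp
    qed
  qed
qed auto

text \<open>The integrand may jump at radius \<open>a\<close>, so the pieces on
  \<open>{0..a}\<close> and \<open>{a..R}\<close>, each with a continuous integrand, are computed
  apart. The inner one contributes the term with \<open>A\<close>; the outer one is left as a
  one-dimensional integral \<open>I\<close>, to be filled in by the closed forms below.\<close>

lemma has_bochner_integral_radial:
  fixes k :: "real \<Rightarrow> real"
  assumes a: "0 \<le> a" "a \<le> R" and k: "continuous_on UNIV k"
    and I: "((\<lambda>s. real CARD('n) * s ^ (CARD('n) - 1) * k s) has_integral I) {a..R}"
  shows "has_bochner_integral lborel
    (\<lambda>x::real^'n. indicator (ball 0 R) x * (if norm x < a then A else k (norm x)))
    (unit_ball_volume TYPE('n) * (a ^ CARD('n) * A + I))"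
proof -
  define v where "v = unit_ball_volume TYPE('n)"
  have v: "v > 0" unfolding v_def by (rule unit_ball_volume_pos)
  have [measurable]: "ball (0::real^'n) R \<in> sets borel" by simp
  define h where "h s = (if s < a then A else k s)" for s
  have [measurable]: "k \<in> borel_measurable borel" using k by (rule borel_measurable_continuous_onI)
  have [measurable]: "h \<in> borel_measurable borel" unfolding h_def by measurable
  define p where "p s = v * (real CARD('n) * s ^ (CARD('n) - 1))" for s
  have [measurable]: "p \<in> borel_measurable borel" unfolding p_def by measurable
  have p0: "0 \<le> indicator {0..R} s * p s" for s using v by (auto simp: p_def indicator_def)
  have 1: "has_bochner_integral lborel (\<lambda>s. indicator {0..a} s *\<^sub>R (p s * A)) (v * a ^ CARD('n) * A)"
  proof -
    have c: "continuous_on {0..a} (\<lambda>s. p s * A)" unfolding p_def by (intro continuous_intros)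
    have "(\<integral>s. indicator {0..a} s *\<^sub>R (p s * A) \<partial>lborel) =
       (\<lambda>s. v * s ^ CARD('n) * A) a - (\<lambda>s. v * s ^ CARD('n) * A) 0"
      unfolding p_def
      by (intro integral_FTC_atLeastAtMost a continuous_intros)
        (auto simp: has_real_derivative_iff_has_vector_derivative[symmetric] intro!: derivative_eq_intros)
    then show ?thesis
      using borel_integrable_atLeastAtMost'[OF c]
      by (simp add: has_bochner_integral_iff set_integrable_def power_0_left)
  qed
  have 2: "has_bochner_integral lborel (\<lambda>s. indicator {a..R} s *\<^sub>R (p s * k s)) (v * I)"
  proof -
    have c: "continuous_on {a..R} (\<lambda>s. p s * k s)" unfolding p_def
      by (intro continuous_intros continuous_on_subset[OF k]) auto
    note i = borel_integrable_atLeastAtMost'[OF c]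
    have "((\<lambda>s. p s * k s) has_integral v * I) {a..R}"
      using has_integral_mult_right[OF I, of v] by (simp add: p_def mult_ac)
    then have "(LINT s:{a..R}|lborel. p s * k s) = v * I"
      using set_borel_integral_eq_integral(2)[OF i] by (simp add: integral_unique)
    then show ?thesis
      using i by (simp add: has_bochner_integral_iff set_integrable_def set_lebesgue_integral_def)
  qed
  have "has_bochner_integral lborel
      (\<lambda>s. indicator {0..a} s *\<^sub>R (p s * A) + indicator {a..R} s *\<^sub>R (p s * k s)) (v * a ^ CARD('n) * A + v * I)"
    using 1 2 by (rule has_bochner_integral_add)
  \<comment> \<open>Both intervals contain \<open>a\<close>; this overlap is a null set.\<close>
  also have "?this \<longleftrightarrow> has_bochner_integral lborel (\<lambda>s. (indicator {0..R} s * p s) *\<^sub>R h s)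
      (v * a ^ CARD('n) * A + v * I)"
    using AE_lborel_singleton[of a] a
    by (intro has_bochner_integral_cong_AE) (auto simp: indicator_def h_def)
  finally have "has_bochner_integral (density lborel (\<lambda>s. ennreal (indicator {0..R} s * p s))) h
      (v * a ^ CARD('n) * A + v * I)"
    using p0 by (intro has_bochner_integral_density) auto
  then have "has_bochner_integral (distr (density lborel (\<lambda>x. ennreal (indicator (ball (0::real^'n) R) x))) borel norm) h
      (v * a ^ CARD('n) * A + v * I)"
    using a by (simp add: distr_norm_ball p_def v_def)
  then have "has_bochner_integral (density lborel (\<lambda>x. ennreal (indicator (ball (0::real^'n) R) x))) (\<lambda>x. h (norm x))
      (v * a ^ CARD('n) * A + v * I)"
    by (simp add: has_bochner_integral_iff integrable_distr_eq integral_distr)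
  then show ?thesis
    by (simp add: has_bochner_integral_iff integrable_density integral_density h_def[symmetric] v_def
        distrib_left mult_ac)
qed

section \<open>The one-dimensional integrals\<close>

text \<open>The antiderivative is a polynomial of degree \<open>n - 1\<close> times
  \<open>exp (- (c * (R - s)))\<close>, as repeated integration by parts suggests. Its coefficients
  \<open>b k\<close> are determined from the top by \<open>c * b (n - 1) = n\<close> and
  \<open>(k + 1) * b (k + 1) + c * b k = 0\<close>, so that in the derivative every power of
  \<open>s\<close> below \<open>n - 1\<close> cancels. Solving this recursion produces the negative
  powers of \<open>c\<close>.\<close>

lemma has_integral_power_exp:
  fixes c R a :: real
  assumes "c > 0" "a \<le> R" "n > 0"
  shows "((\<lambda>s. real n * s ^ (n - 1) * exp (- (c * (R - s)))) has_integral
     fact n * (\<Sum>k<n. (-1) ^ (n - k - 1) / fact k * c powi (int k - int n)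
         * (R ^ k - a ^ k * exp (- (c * (R - a)))))) {a..R}"
proof -
  define b where "b k = fact n * ((-1) ^ (n - k - 1) / fact k * c powi (int k - int n))" for k
  have b_Suc: "real (Suc k) * b (Suc k) = - c * b k" if "Suc k < n" for k
  proof -
    have "n - k - 1 = Suc (n - Suc k - 1)" using that by simp
    then have "(-1::real) ^ (n - k - 1) = - ((-1) ^ (n - Suc k - 1))" by simp
    moreover have "c powi (int (Suc k) - int n) = c * c powi (int k - int n)"
      using assms(1) by (subst power_int_add_1'[symmetric]) (auto simp: algebra_simps)
    ultimately show ?thesis
      by (simp add: b_def divide_simps del: of_nat_Suc)
  qed
  have b_last: "c * b (n - 1) = real n"
  proof -
    have "int (n - 1) - int n = -1" using assms by simp
    then have "b (n - 1) = fact n * (inverse c / fact (n - 1))"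
      using assms by (simp add: b_def power_int_minus)
    then show ?thesis using assms by (simp add: fact_reduce)
  qed
  have tel: "(\<Sum>k<m. real k * b k * s ^ (k - 1) + c * b k * s ^ k) = c * b (m - 1) * s ^ (m - 1)"
    if "0 < m" "m \<le> n" for m s
    using that
  proof (induction m)
    case (Suc m)
    show ?case
    proof (cases m)
      case (Suc k)
      then show ?thesis using Suc.IH Suc.prems b_Suc[of k]
        by (simp add: algebra_simps)
    qed simp
  qed simp
  have "((\<lambda>s. real n * s ^ (n - 1) * exp (- (c * (R - s)))) has_integral
     (\<Sum>k<n. b k * R ^ k * exp (- (c * (R - R)))) - (\<Sum>k<n. b k * a ^ k * exp (- (c * (R - a))))) {a..R}"
  proof (intro fundamental_theorem_of_calculus assms)
    fix s
    have "((\<lambda>s. \<Sum>k<n. b k * s ^ k * exp (- (c * (R - s)))) has_real_derivative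
       (\<Sum>k<n. (real k * b k * s ^ (k - 1) + c * b k * s ^ k) * exp (- (c * (R - s))))) (at s within {a..R})"
      by (auto intro!: derivative_eq_intros sum.cong simp: algebra_simps)
    also have "(\<Sum>k<n. (real k * b k * s ^ (k - 1) + c * b k * s ^ k) * exp (- (c * (R - s))))
       = real n * s ^ (n - 1) * exp (- (c * (R - s)))"
      using tel[of n s] assms b_last by (simp add: sum_distrib_right[symmetric])
    finally show "((\<lambda>s. \<Sum>k<n. b k * s ^ k * exp (- (c * (R - s)))) has_vector_derivative
       real n * s ^ (n - 1) * exp (- (c * (R - s)))) (at s within {a..R})"
      by (simp add: has_real_derivative_iff_has_vector_derivative)
  qed
  then show ?thesis
    by (simp add: b_def sum_subtractf[symmetric] sum_distrib_left algebra_simps diff_divide_distrib)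
qed

text \<open>For positive \<open>L\<close> and \<open>n\<close> this is proportional to an incomplete
  gamma function via \<open>t = L * u ^ n\<close>. The form in \<open>u\<close> has a continuous
  integrand, whereas \<open>t powr (s - 1)\<close> blows up near \<open>0\<close> when
  \<open>s < 1\<close>.\<close>

definition stretched_exp_integral :: "real \<Rightarrow> nat \<Rightarrow> nat \<Rightarrow> real \<Rightarrow> real" where
  "stretched_exp_integral L n i y = integral {0..y} (\<lambda>u. u ^ i * exp (- (L * u ^ n)))"

lemma continuous_on_stretched_exp_integral: "continuous_on {0..y} (stretched_exp_integral L n i)"
  unfolding stretched_exp_integral_def
  by (intro indefinite_integral_continuous_1 integrable_continuous_interval continuous_intros)

lemma DERIV_stretched_exp_integral:
  assumes "u > 0"
  shows "DERIV (stretched_exp_integral L n i) u :> u ^ i * exp (- (L * u ^ n))"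
proof -
  have "((\<lambda>x. integral {0..x} (\<lambda>u. u ^ i * exp (- (L * u ^ n)))) has_real_derivative
    u ^ i * exp (- (L * u ^ n))) (at u within {0..u + 1})"
    using assms by (intro integral_has_real_derivative continuous_intros) auto
  then show ?thesis
    using assms at_within_Icc_at[of 0 u "u + 1"]
    by (simp add: stretched_exp_integral_def[abs_def])
qed

text \<open>With \<open>t = L * u ^ n\<close> and \<open>s = (i + 1) / n\<close> one has
  \<open>t powr (s - 1) dt = n * L powr s * u ^ i du\<close>. Composing with the inverse
  substitution \<open>U\<close> exhibits an antiderivative, which also shows that the integral in
  \<open>lower_inc_gamma\<close> exists.\<close>

lemma lower_inc_gamma_stretched_exp:
  assumes L: "L > 0" and n: "n > 0" and y: "y > 0"
  shows "lower_inc_gamma (real (i + 1) / real n) (L * y ^ n) =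
    real n * L powr (real (i + 1) / real n) * stretched_exp_integral L n i y"
proof -
  define s where "s = real (i + 1) / real n"
  define U where "U t = (t / L) powr (1 / real n)" for t
  let ?K = "stretched_exp_integral L n i"
  have U: "U (L * y ^ n) = y" "U 0 = 0"
    using assms by (auto simp: U_def powr_realpow[symmetric] powr_powr)
  have "((\<lambda>t. t powr (s - 1) * exp (- t)) has_integral
     (real n * L powr s * ?K (U (L * y ^ n)) - real n * L powr s * ?K (U 0))) {0..L * y ^ n}"
  \<comment> \<open>Derivatives are taken only in the open interval: near \<open>0\<close> the
    integrand and the derivative of \<open>U\<close> can be unbounded, but the antiderivative is
    continuous up to the endpoints.\<close>
  proof (intro fundamental_theorem_of_calculus_interior)
    show "0 \<le> L * y ^ n" using assms by simp
    have "continuous_on {0..L * y ^ n} U"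
      unfolding U_def using assms by (intro continuous_on_powr' continuous_intros) auto
    moreover have "U ` {0..L * y ^ n} \<subseteq> {0..y}"
    proof safe
      fix t assume "t \<in> {0..L * y ^ n}"
      then have "U t \<le> U (L * y ^ n)"
        unfolding U_def using assms by (intro powr_mono2 divide_right_mono) auto
      then show "U t \<in> {0..y}" using U by (simp add: U_def)
    qed
    ultimately show "continuous_on {0..L * y ^ n} (\<lambda>t. real n * L powr s * ?K (U t))"
      by (intro continuous_intros continuous_on_compose2[OF continuous_on_stretched_exp_integral])
    fix t assume t: "t \<in> {0<..<L * y ^ n}"
    have Un: "U t ^ n = t / L"
      using t L n by (simp add: U_def powr_realpow[symmetric] powr_powr)
    have Ui: "U t ^ i = (t / L) powr (real i / real n)"
      using t L n by (simp add: U_def powr_realpow[symmetric] powr_powr)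
    have Upos: "U t > 0" using t L by (simp add: U_def)
    have "DERIV U t :> 1 / real n * (t / L) powr (1 / real n - 1) * (1 / L)"
      unfolding U_def using t L n
      by (auto intro!: derivative_eq_intros simp: field_simps powr_diff)
    then have "DERIV (\<lambda>t. ?K (U t)) t :> (U t ^ i * exp (- (L * U t ^ n)))
        * (1 / real n * (t / L) powr (1 / real n - 1) * (1 / L))"
      by (intro DERIV_chain2[where f = "?K" and g = U] DERIV_stretched_exp_integral Upos)
    then have "DERIV (\<lambda>t. real n * L powr s * ?K (U t)) t :> real n * L powr s *
        ((U t ^ i * exp (- (L * U t ^ n))) * (1 / real n * (t / L) powr (1 / real n - 1) * (1 / L)))"
      by (rule DERIV_cmult)
    also have "real n * L powr s *
        ((U t ^ i * exp (- (L * U t ^ n))) * (1 / real n * (t / L) powr (1 / real n - 1) * (1 / L)))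
      = (L powr s / L) * ((t / L) powr (real i / real n) * (t / L) powr (1 / real n - 1)) * exp (- t)"
      unfolding Un Ui using n L by simp
    also have "(t / L) powr (real i / real n) * (t / L) powr (1 / real n - 1) = (t / L) powr (s - 1)"
    proof -
      have "real i / real n + (1 / real n - 1) = s - 1" by (simp add: s_def add_divide_distrib)
      then show ?thesis by (simp only: powr_add[symmetric])
    qed
    also have "L powr s / L = L powr (s - 1)"
      using L by (simp add: powr_diff)
    also have "L powr (s - 1) * (t / L) powr (s - 1) = t powr (s - 1)"
      using t L by (simp add: powr_divide)
    finally show "((\<lambda>t. real n * L powr s * ?K (U t)) has_vector_derivative t powr (s - 1) * exp (- t)) (at t)"
      by (simp add: has_real_derivative_iff_has_vector_derivative)
  qed
  moreover have "?K 0 = 0" by (simp add: stretched_exp_integral_def)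
  ultimately show ?thesis
    unfolding lower_inc_gamma_def s_def[symmetric] by (simp add: U integral_unique)
qed

text \<open>Substituting \<open>u = (R - s) / 2\<close> turns \<open>s ^ (n - 1)\<close> into
  \<open>(R - 2 * u) ^ (n - 1)\<close>, and the binomial theorem leaves one stretched exponential
  integral per power of \<open>u\<close>. The factor \<open>(-1) ^ i * 2 ^ (i + 1)\<close> collects
  \<open>(-2) ^ i\<close> from the expansion and \<open>2\<close> from
  \<open>ds = -2 du\<close>.\<close>

lemma has_integral_power_exp_power:
  fixes L R a :: real
  assumes L: "L > 0" and a: "0 \<le> a" "a < R" and n: "n > 0"
  shows "((\<lambda>s. real n * s ^ (n - 1) * exp (- (L * ((R - s) / 2) ^ n))) has_integral
     R ^ n * (\<Sum>i<n. real ((n - 1) choose i) * (-1) ^ i * 2 ^ (i + 1)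
       * (L * R ^ n) powr (- (real (i + 1) / real n))
       * lower_inc_gamma (real (i + 1) / real n) (L * ((R - a) / 2) ^ n))) {a..R}"
proof -
  let ?K = "stretched_exp_integral L n"
  define b where "b i = real n * (real ((n - 1) choose i) * (-2) ^ i * R ^ (n - 1 - i))" for i
  have "((\<lambda>s. real n * s ^ (n - 1) * exp (- (L * ((R - s) / 2) ^ n))) has_integral
     (\<Sum>i<n. -2 * b i * ?K i ((R - R) / 2)) - (\<Sum>i<n. -2 * b i * ?K i ((R - a) / 2))) {a..R}"
  proof (intro fundamental_theorem_of_calculus_interior)
    show "a \<le> R" using a by simp
    show "continuous_on {a..R} (\<lambda>s. \<Sum>i<n. -2 * b i * ?K i ((R - s) / 2))"
      by (intro continuous_intros
          continuous_on_compose2[OF continuous_on_stretched_exp_integral[of "(R - a) / 2"]]) auto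
    fix s assume s: "s \<in> {a<..<R}"
    let ?u = "(R - s) / 2"
    have d: "DERIV (\<lambda>s. ?K i ((R - s) / 2)) s :> ?u ^ i * exp (- (L * ?u ^ n)) * (- 1 / 2)" for i
      using s by (intro DERIV_chain2[OF DERIV_stretched_exp_integral])
        (auto intro!: derivative_eq_intros)
    have "DERIV (\<lambda>s. \<Sum>i<n. -2 * b i * ?K i ((R - s) / 2)) s :>
       (\<Sum>i<n. -2 * b i * (?u ^ i * exp (- (L * ?u ^ n)) * (- 1 / 2)))"
      by (intro DERIV_sum DERIV_cmult d)
    also have "(\<Sum>i<n. -2 * b i * (u ^ i * exp (- (L * u ^ n)) * (- 1 / 2)))
       = real n * (\<Sum>i<n. real ((n - 1) choose i) * (-2 * u) ^ i * R ^ (n - 1 - i)) * exp (- (L * u ^ n))" for u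
      by (simp only: power_mult_distrib) (simp add: b_def sum_distrib_left sum_distrib_right mult_ac)
    also have "(\<Sum>i<n. real ((n - 1) choose i) * (-2 * ?u) ^ i * R ^ (n - 1 - i)) = s ^ (n - 1)"
    proof -
      have "s ^ (n - 1) = (-2 * ?u + R) ^ (n - 1)" by (simp add: field_simps)
      also have "\<dots> = (\<Sum>i\<le>n - 1. real ((n - 1) choose i) * (-2 * ?u) ^ i * R ^ (n - 1 - i))"
        by (rule binomial_ring)
      also have "{..n - 1} = {..<n}" using n by auto
      finally show ?thesis by simp
    qed
    finally show "((\<lambda>s. \<Sum>i<n. -2 * b i * ?K i ((R - s) / 2)) has_vector_derivative
       real n * s ^ (n - 1) * exp (- (L * ?u ^ n))) (at s)"
      by (simp add: has_real_derivative_iff_has_vector_derivative)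
  qed
  also have "(\<Sum>i<n. -2 * b i * ?K i ((R - R) / 2)) - (\<Sum>i<n. -2 * b i * ?K i ((R - a) / 2))
     = (\<Sum>i<n. 2 * b i * ?K i ((R - a) / 2))"
    by (simp add: stretched_exp_integral_def sum_negf[symmetric])
  also have "\<dots> = R ^ n * (\<Sum>i<n. real ((n - 1) choose i) * (-1) ^ i * 2 ^ (i + 1)
       * (L * R ^ n) powr (- (real (i + 1) / real n))
       * lower_inc_gamma (real (i + 1) / real n) (L * ((R - a) / 2) ^ n))"
    unfolding sum_distrib_left
  proof (intro sum.cong refl)
    fix i assume "i \<in> {..<n}"
    then have i: "i < n" by simp
    define s where "s = real (i + 1) / real n"
    \<comment> \<open>The power of \<open>L * R ^ n\<close> does two things: its \<open>R\<close>
      part lowers \<open>R ^ n\<close> to the binomial factor \<open>R ^ (n - 1 - i)\<close>, and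
      its \<open>L\<close> part cancels the \<open>L powr s\<close> produced by the incomplete gamma
      function.\<close>
    have split: "R ^ n = R ^ (n - 1 - i) * R ^ (i + 1)"
      using i by (subst power_add[symmetric]) simp
    have inv: "(R ^ n) powr (- s) = inverse (R ^ (i + 1))"
      using a n by (simp add: s_def powr_minus powr_realpow[symmetric] powr_powr del: of_nat_Suc of_nat_add)
        (simp add: powr_realpow add.commute flip: of_nat_Suc)
    have "R ^ n * (R ^ n) powr (- s) = R ^ (n - 1 - i) * (R ^ (i + 1) * inverse (R ^ (i + 1)))"
      unfolding inv by (subst split) (simp only: mult.assoc)
    also have "R ^ (i + 1) * inverse (R ^ (i + 1)) = 1" using a by (intro right_inverse) auto
    finally have "R ^ n * (R ^ n) powr (- s) = R ^ (n - 1 - i)" by simp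
    then have "R ^ n * (L * R ^ n) powr (- s) = R ^ (n - 1 - i) * L powr (- s)"
      using a L by (simp add: powr_mult mult_ac)
    note scale = this
    have gam: "lower_inc_gamma s (L * ((R - a) / 2) ^ n) = real n * L powr s * ?K i ((R - a) / 2)"
      unfolding s_def using a by (intro lower_inc_gamma_stretched_exp L n) auto
    have pq: "L powr (- s) * L powr s = 1" using L by (simp add: powr_minus)
    have "R ^ n * (real ((n - 1) choose i) * (-1) ^ i * 2 ^ (i + 1) * (L * R ^ n) powr (- s)
        * lower_inc_gamma s (L * ((R - a) / 2) ^ n)) =
      real ((n - 1) choose i) * (-1) ^ i * 2 ^ (i + 1) * (R ^ n * (L * R ^ n) powr (- s))
        * lower_inc_gamma s (L * ((R - a) / 2) ^ n)"
      by (simp only: mult_ac)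
    also have "\<dots> = real ((n - 1) choose i) * ((-1) ^ i * 2 ^ (i + 1)) * R ^ (n - 1 - i)
        * (L powr (- s) * L powr s) * (real n * ?K i ((R - a) / 2))"
      unfolding scale gam by (simp only: mult_ac)
    also have "(-1) ^ i * 2 ^ (i + 1) = 2 * (-2::real) ^ i"
    proof -
      have "(-2::real) ^ i = (-1) ^ i * 2 ^ i" by (simp flip: power_mult_distrib)
      then show ?thesis by simp
    qed
    also have "real ((n - 1) choose i) * (2 * (-2) ^ i) * R ^ (n - 1 - i)
        * (L powr (- s) * L powr s) * (real n * ?K i ((R - a) / 2)) = 2 * b i * ?K i ((R - a) / 2)"
      unfolding pq b_def by simp
    finally show "2 * b i * ?K i ((R - a) / 2) = R ^ n * (real ((n - 1) choose i) * (-1) ^ i * 2 ^ (i + 1)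
       * (L * R ^ n) powr (- (real (i + 1) / real n))
       * lower_inc_gamma (real (i + 1) / real n) (L * ((R - a) / 2) ^ n))"
      unfolding s_def by (rule sym)
  qed
  finally show ?thesis .
qed

section \<open>Product functional of a Poisson process\<close>

lemma poisson_pp_measurable_pcount:
  assumes "poisson_pp M P lam S" "A \<in> sets borel" "bounded A"
  shows "pcount P A \<in> measurable M (count_space UNIV)"
proof -
  have "pcount P A -` {k} \<inter> space M = {w \<in> space M. pcount P A w = k}" for k by auto
  then show ?thesis
    using assms by (auto simp: measurable_count_space_eq2_countable poisson_pp_def)
qed

text \<open>The exponential series at \<open>\<mu> * c\<close>. The case \<open>c = 0\<close>, with
  \<open>0 ^ 0 = 1\<close>, gives the void probability; it occurs below on the level set where the
  step function vanishes.\<close>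

lemma poisson_pp_generating_function:
  assumes M: "prob_space M" and P: "poisson_pp M P lam S" and A: "A \<in> sets borel" "bounded A"
    and lam: "lam \<ge> 0" and c: "0 \<le> c" "c \<le> 1"
  shows "(\<integral>w. c ^ pcount P A w \<partial>M) = exp (- (lam * measure lborel (A \<inter> S)) * (1 - c))"
proof -
  interpret prob_space M by (rule M)
  define \<mu> where "\<mu> = lam * measure lborel (A \<inter> S)"
  define p where "p k = exp (- \<mu>) * \<mu> ^ k / fact k" for k
  have \<mu>: "\<mu> \<ge> 0" using lam by (simp add: \<mu>_def)
  then have p: "p k \<ge> 0" for k by (simp add: p_def)
  note N [measurable] = poisson_pp_measurable_pcount[OF P A]
  have prob: "prob {w \<in> space M. pcount P A w = k} = p k" for k
    using P A unfolding poisson_pp_def p_def \<mu>_def by simp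
  have "distr M (count_space UNIV) (pcount P A) = density (count_space UNIV) (\<lambda>k. ennreal (p k))"
  proof (rule measure_eqI_countable[where A = UNIV])
    fix k :: nat
    have "pcount P A -` {k} \<inter> space M = {w \<in> space M. pcount P A w = k}" by auto
    then show "emeasure (distr M (count_space UNIV) (pcount P A)) {k}
      = emeasure (density (count_space UNIV) (\<lambda>k. ennreal (p k))) {k}"
      by (simp add: emeasure_distr emeasure_eq_measure prob emeasure_density
          nn_integral_count_space_indicator[symmetric])
  qed auto
  moreover have "(\<integral>w. c ^ pcount P A w \<partial>M) = (\<integral>k. c ^ k \<partial>distr M (count_space UNIV) (pcount P A))"
    by (rule integral_distr[symmetric]) auto
  ultimately have "(\<integral>w. c ^ pcount P A w \<partial>M) = (\<integral>k. p k * c ^ k \<partial>count_space UNIV)"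
    using p by (simp add: integral_density)
  moreover have s: "(\<lambda>k. p k * c ^ k) sums exp (- \<mu> * (1 - c))"
  proof -
    have "(\<lambda>k. exp (- \<mu>) * ((\<mu> * c) ^ k /\<^sub>R fact k)) sums (exp (- \<mu>) * exp (\<mu> * c))"
      by (intro sums_mult exp_converges)
    moreover have "exp (- \<mu>) * exp (\<mu> * c) = exp (- \<mu> * (1 - c))"
      by (simp add: exp_add[symmetric] algebra_simps)
    ultimately show ?thesis
      by (simp add: p_def power_mult_distrib divide_inverse mult_ac)
  qed
  moreover have "integrable (count_space UNIV) (\<lambda>k. p k * c ^ k)"
    using s p c by (simp add: integrable_count_space_nat_iff abs_mult sums_iff)
  ultimately show ?thesis
    by (simp add: integral_count_space_nat sums_iff \<mu>_def)
qed

text \<open>The product of a step function with value \<open>c j\<close> on \<open>A j\<close>,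
  taken over the points of the process, sees only the counts in the sets \<open>A j\<close>. These
  are independent, so the expectation splits into generating functions.\<close>

lemma poisson_pp_product_functional_discrete:
  fixes A :: "nat \<Rightarrow> 'a::euclidean_space set"
  assumes M: "prob_space M" and P: "poisson_pp M P lam S" and J: "finite J"
    and A: "\<And>j. j \<in> J \<Longrightarrow> A j \<in> sets borel" "\<And>j. j \<in> J \<Longrightarrow> bounded (A j)" "disjoint_family_on A J"
    and lam: "lam \<ge> 0" and c: "\<And>j. j \<in> J \<Longrightarrow> 0 \<le> c j" "\<And>j. j \<in> J \<Longrightarrow> c j \<le> 1"
  shows "(\<integral>w. (\<Prod>j\<in>J. c j ^ pcount P (A j) w) \<partial>M)
    = exp (- lam * (\<Sum>j\<in>J. measure lborel (A j \<inter> S) * (1 - c j)))"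
proof -
  interpret prob_space M by (rule M)
  have "\<forall>(J::nat set) A. finite J \<and> (\<forall>j\<in>J. A j \<in> sets borel \<and> bounded (A j)) \<and>
      disjoint_family_on A J \<longrightarrow> indep_vars (\<lambda>_. count_space UNIV) (\<lambda>j. pcount P (A j)) J"
    using P unfolding poisson_pp_def by (elim conjE)
  then have "indep_vars (\<lambda>_. count_space UNIV) (\<lambda>j. pcount P (A j)) J"
    by (elim allE[where x = J] allE[where x = A] mp) (simp add: J A)
  then have "indep_vars (\<lambda>_. borel) (\<lambda>j w. c j ^ pcount P (A j) w) J"
    by (rule indep_vars_compose2) auto
  moreover have "integrable M (\<lambda>w. c j ^ pcount P (A j) w)" if "j \<in> J" for j
  proof (rule integrable_const_bound[where B = 1])
    note [measurable] = poisson_pp_measurable_pcount[OF P A(1,2)[OF that]]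
    show "(\<lambda>w. c j ^ pcount P (A j) w) \<in> borel_measurable M" by measurable
  qed (use c that in \<open>auto intro!: power_le_one\<close>)
  ultimately have "(\<integral>w. (\<Prod>j\<in>J. c j ^ pcount P (A j) w) \<partial>M)
    = (\<Prod>j\<in>J. \<integral>w. c j ^ pcount P (A j) w \<partial>M)"
    by (intro indep_vars_lebesgue_integral J) auto
  also have "\<dots> = (\<Prod>j\<in>J. exp (- (lam * measure lborel (A j \<inter> S)) * (1 - c j)))"
    by (intro prod.cong poisson_pp_generating_function[OF M P] A lam c) auto
  also have "\<dots> = exp (\<Sum>j\<in>J. - (lam * measure lborel (A j \<inter> S)) * (1 - c j))"
    by (rule exp_sum[OF J, symmetric])
  finally show ?thesis by (simp add: sum_distrib_left sum_negf mult_ac)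
qed

lemma floor_approx_tendsto:
  fixes x :: real
  assumes "x \<ge> 0"
  shows "(\<lambda>m. real (nat \<lfloor>real (Suc m) * x\<rfloor>) / real (Suc m)) \<longlonglongrightarrow> x"
proof (rule tendsto_sandwich)
  have b: "x - 1 / real (Suc m) \<le> real (nat \<lfloor>real (Suc m) * x\<rfloor>) / real (Suc m)"
    "real (nat \<lfloor>real (Suc m) * x\<rfloor>) / real (Suc m) \<le> x" for m
  proof -
    have f: "real (nat \<lfloor>real (Suc m) * x\<rfloor>) = of_int \<lfloor>real (Suc m) * x\<rfloor>"
      using assms by (intro of_nat_nat) simp
    have "of_int \<lfloor>real (Suc m) * x\<rfloor> \<le> real (Suc m) * x"
      "real (Suc m) * x - 1 \<le> of_int \<lfloor>real (Suc m) * x\<rfloor>"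
      by linarith+
    then have "of_int \<lfloor>real (Suc m) * x\<rfloor> / real (Suc m) \<le> real (Suc m) * x / real (Suc m)"
      "(real (Suc m) * x - 1) / real (Suc m) \<le> of_int \<lfloor>real (Suc m) * x\<rfloor> / real (Suc m)"
      by (intro divide_right_mono; simp)+
    then show "x - 1 / real (Suc m) \<le> real (nat \<lfloor>real (Suc m) * x\<rfloor>) / real (Suc m)"
      "real (nat \<lfloor>real (Suc m) * x\<rfloor>) / real (Suc m) \<le> x"
      unfolding f by (simp_all add: diff_divide_distrib del: of_nat_Suc)
  qed
  show "\<forall>\<^sub>F m in sequentially. x - 1 / real (Suc m) \<le> real (nat \<lfloor>real (Suc m) * x\<rfloor>) / real (Suc m)"
    using b by simp
  show "\<forall>\<^sub>F m in sequentially. real (nat \<lfloor>real (Suc m) * x\<rfloor>) / real (Suc m) \<le> x"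
    using b by simp
  have "(\<lambda>m. x - 1 / real (Suc m)) \<longlonglongrightarrow> x - 0"
    using LIMSEQ_Suc[OF lim_1_over_n] by (intro tendsto_diff tendsto_const) auto
  then show "(\<lambda>m. x - 1 / real (Suc m)) \<longlonglongrightarrow> x" by simp
qed simp

text \<open>Rounding \<open>g\<close> down to multiples of \<open>1 / (m + 1)\<close> gives level
  sets in \<open>B\<close> that are finitely many disjoint bounded Borel sets. The grids are not
  nested, so the limit is taken by dominated convergence, with majorant \<open>1\<close> over the
  sample space and the indicator of \<open>B\<close> for Lebesgue measure.\<close>

lemma poisson_pp_product_functional:
  fixes g :: "'a::euclidean_space \<Rightarrow> real"
  assumes M: "prob_space M" and P: "poisson_pp M P lam UNIV" and lam: "lam \<ge> 0"
    and B: "B \<in> sets borel" "bounded B"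
    and g: "g \<in> borel_measurable borel" "\<And>x. 0 \<le> g x" "\<And>x. g x \<le> 1"
  shows "has_bochner_integral M (\<lambda>w. \<Prod>x\<in>P w \<inter> B. g x)
    (exp (- lam * (\<integral>x. indicator B x * (1 - g x) \<partial>lborel)))"
proof -
  interpret prob_space M by (rule M)
  note [measurable] = g(1) B(1)
  define gm where "gm m x = real (nat \<lfloor>real (Suc m) * g x\<rfloor>) / real (Suc m)" for m x
  define A where "A m j = {x \<in> B. nat \<lfloor>real (Suc m) * g x\<rfloor> = j}" for m j
  have [measurable]: "A m j \<in> sets borel" for m j unfolding A_def by measurable
  have [measurable]: "gm m \<in> borel_measurable borel" for m unfolding gm_def by measurable
  have A_bounded: "bounded (A m j)" for m j
    by (rule bounded_subset[OF B(2)]) (auto simp: A_def)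
  have A_disj: "disjoint_family_on (A m) {..Suc m}" for m
    by (auto simp: disjoint_family_on_def A_def)
  \<comment> \<open>Level \<open>Suc m\<close> occurs only where \<open>g x = 1\<close>, hence the
    index set \<open>{..Suc m}\<close>.\<close>
  have range: "nat \<lfloor>real (Suc m) * g x\<rfloor> \<le> Suc m" for m x
  proof -
    have "real (Suc m) * g x \<le> real (Suc m)"
      using mult_left_mono[of "g x" 1 "real (Suc m)"] g by simp
    then have "\<lfloor>real (Suc m) * g x\<rfloor> \<le> \<lfloor>real (Suc m)\<rfloor>" by (rule floor_mono)
    also have "\<lfloor>real (Suc m)\<rfloor> = int (Suc m)" by (rule floor_of_nat)
    finally show ?thesis by (simp only: nat_le_iff)
  qed
  have gm: "0 \<le> gm m x" "gm m x \<le> 1" for m x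
    using range[of m x] by (auto simp: gm_def divide_simps simp del: of_nat_Suc)
  have fin: "finite (P w \<inter> B)" if "w \<in> space M" for w
    using P B that by (auto simp: poisson_pp_def)
  have prod_eq: "(\<Prod>x\<in>P w \<inter> B. gm m x) = (\<Prod>j\<le>Suc m. (real j / real (Suc m)) ^ pcount P (A m j) w)"
    if "w \<in> space M" for w m
  proof -
    have "(\<Prod>x\<in>P w \<inter> B. gm m x) =
        (\<Prod>j\<le>Suc m. \<Prod>x\<in>{x \<in> P w \<inter> B. nat \<lfloor>real (Suc m) * g x\<rfloor> = j}. gm m x)"
      using range by (intro prod.group[symmetric] fin that) auto
    also have "\<dots> = (\<Prod>j\<le>Suc m. (real j / real (Suc m)) ^ pcount P (A m j) w)"
    proof (intro prod.cong refl)
      fix j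
      have "{x \<in> P w \<inter> B. nat \<lfloor>real (Suc m) * g x\<rfloor> = j} = P w \<inter> A m j"
        by (auto simp: A_def)
      moreover have "(\<Prod>x\<in>P w \<inter> A m j. gm m x) = (\<Prod>x\<in>P w \<inter> A m j. real j / real (Suc m))"
        by (intro prod.cong refl) (auto simp: A_def gm_def)
      ultimately show "(\<Prod>x\<in>{x \<in> P w \<inter> B. nat \<lfloor>real (Suc m) * g x\<rfloor> = j}. gm m x)
          = (real j / real (Suc m)) ^ pcount P (A m j) w"
        by (simp add: pcount_def)
    qed
    finally show ?thesis .
  qed
  have prod_meas: "(\<lambda>w. \<Prod>x\<in>P w \<inter> B. gm m x) \<in> borel_measurable M" for m
  proof -
    have [measurable]: "pcount P (A m j) \<in> measurable M (count_space UNIV)" for j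
      by (rule poisson_pp_measurable_pcount[OF P _ A_bounded]) simp
    have "(\<lambda>w. \<Prod>j\<le>Suc m. (real j / real (Suc m)) ^ pcount P (A m j) w) \<in> borel_measurable M"
      by measurable
    then show ?thesis by (subst measurable_cong[OF prod_eq])
  qed
  have lim: "(\<lambda>m. \<Prod>x\<in>P w \<inter> B. gm m x) \<longlonglongrightarrow> (\<Prod>x\<in>P w \<inter> B. g x)" for w
    unfolding gm_def by (intro tendsto_prod floor_approx_tendsto g)
  have meas: "(\<lambda>w. \<Prod>x\<in>P w \<inter> B. g x) \<in> borel_measurable M"
    by (rule borel_measurable_LIMSEQ_real[OF lim prod_meas])
  have exp_eq: "(\<integral>w. (\<Prod>x\<in>P w \<inter> B. gm m x) \<partial>M)
      = exp (- lam * (\<integral>x. indicator B x * (1 - gm m x) \<partial>lborel))" for m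
  proof -
    have i: "integrable lborel (\<lambda>x. indicator (A m j) x * (1 - real j / real (Suc m)))" for j
      using emeasure_bounded_finite[OF A_bounded[of m j]]
      by (intro integrable_mult_left integrable_real_indicator) auto
    have "(\<integral>w. (\<Prod>x\<in>P w \<inter> B. gm m x) \<partial>M)
      = (\<integral>w. (\<Prod>j\<le>Suc m. (real j / real (Suc m)) ^ pcount P (A m j) w) \<partial>M)"
      by (intro Bochner_Integration.integral_cong refl prod_eq)
    also have "\<dots> = exp (- lam * (\<Sum>j\<le>Suc m. measure lborel (A m j \<inter> UNIV) * (1 - real j / real (Suc m))))"
      by (intro poisson_pp_product_functional_discrete[OF M P] lam A_disj A_bounded)
        (auto simp del: of_nat_Suc)
    also have "(\<Sum>j\<le>Suc m. measure lborel (A m j \<inter> UNIV) * (1 - real j / real (Suc m)))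
       = (\<Sum>j\<le>Suc m. \<integral>x. indicator (A m j) x * (1 - real j / real (Suc m)) \<partial>lborel)"
      by simp
    also have "\<dots> = (\<integral>x. (\<Sum>j\<le>Suc m. indicator (A m j) x * (1 - real j / real (Suc m))) \<partial>lborel)"
      by (rule Bochner_Integration.integral_sum[symmetric]) (rule i)
    also have "\<dots> = (\<integral>x. indicator B x * (1 - gm m x) \<partial>lborel)"
    proof (intro Bochner_Integration.integral_cong refl)
      fix x
      have "(\<Sum>j\<le>Suc m. indicator (A m j) x * (1 - real j / real (Suc m)))
        = (\<Sum>j\<le>Suc m. if j = nat \<lfloor>real (Suc m) * g x\<rfloor> then indicator B x * (1 - gm m x) else 0)"
        by (intro sum.cong refl) (auto simp: A_def gm_def indicator_def)
      also have "\<dots> = indicator B x * (1 - gm m x)"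
        using range[of m x] by (subst sum.delta) auto
      finally show "(\<Sum>j\<le>Suc m. indicator (A m j) x * (1 - real j / real (Suc m)))
        = indicator B x * (1 - gm m x)" .
    qed
    finally show ?thesis .
  qed
  have prod_bound: "\<bar>\<Prod>x\<in>P w \<inter> B. gm m x\<bar> \<le> 1" for w m
    using gm by (auto intro!: prod_le_1 prod_nonneg simp: abs_prod)
  have 1: "(\<lambda>m. \<integral>w. (\<Prod>x\<in>P w \<inter> B. gm m x) \<partial>M) \<longlonglongrightarrow> (\<integral>w. (\<Prod>x\<in>P w \<inter> B. g x) \<partial>M)"
    by (rule integral_dominated_convergence[where w = "\<lambda>_. 1"])
      (use meas prod_meas lim prod_bound in auto)
  have "(\<lambda>m. \<integral>x. indicator B x * (1 - gm m x) \<partial>lborel) \<longlonglongrightarrow> (\<integral>x. indicator B x * (1 - g x) \<partial>lborel)"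
  proof (rule integral_dominated_convergence[where w = "indicator B"])
    show "integrable lborel (indicator B :: 'a \<Rightarrow> real)"
      using emeasure_bounded_finite[OF B(2)] by (intro integrable_real_indicator) auto
    show "AE x in lborel. (\<lambda>m. indicator B x * (1 - gm m x)) \<longlonglongrightarrow> indicator B x * (1 - g x)"
      unfolding gm_def by (intro AE_I2 tendsto_intros floor_approx_tendsto g)
    show "AE x in lborel. norm (indicator B x * (1 - gm m x)) \<le> indicator B x" for m
    proof (intro AE_I2)
      fix x show "norm (indicator B x * (1 - gm m x)) \<le> indicator B x"
        using gm[of m x] by (auto simp: indicator_def)
    qed
  qed measurable
  then have "(\<lambda>m. \<integral>w. (\<Prod>x\<in>P w \<inter> B. gm m x) \<partial>M)
      \<longlonglongrightarrow> exp (- lam * (\<integral>x. indicator B x * (1 - g x) \<partial>lborel))"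
    unfolding exp_eq by (intro tendsto_intros)
  with 1 have "(\<integral>w. (\<Prod>x\<in>P w \<inter> B. g x) \<partial>M) = exp (- lam * (\<integral>x. indicator B x * (1 - g x) \<partial>lborel))"
    by (rule LIMSEQ_unique)
  moreover have "integrable M (\<lambda>w. \<Prod>x\<in>P w \<inter> B. g x)"
    using g by (intro integrable_const_bound[where B = 1] meas AE_I2)
      (auto intro!: prod_le_1 prod_nonneg simp: abs_prod)
  ultimately show ?thesis by (simp add: has_bochner_integral_iff)
qed

section \<open>Void probabilities of the cluster process\<close>

text \<open>This serves measurability: avoiding a closed ball about a variable centre
  \<open>c\<close> becomes a countable combination of two kinds of conditions, \<open>c\<close>
  being near a fixed point \<open>q k\<close> and \<open>D\<close> meeting a fixed open ball.
  Finiteness of \<open>D\<close> supplies a positive gap \<open>\<delta>\<close> when the closed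
  ball is avoided.\<close>

lemma finite_disjoint_cball_iff:
  fixes D :: "'a::metric_space set"
  assumes D: "finite D" and Q: "\<And>X :: 'a set. open X \<Longrightarrow> X \<noteq> {} \<Longrightarrow> \<exists>k::nat. q k \<in> X"
  shows "D \<inter> cball c r = {} \<longleftrightarrow>
    \<not> (\<forall>m::nat. \<exists>k. dist (q k) c < 1 / real (Suc m) \<and> D \<inter> ball (q k) (r + 1 / real (Suc m)) \<noteq> {})"
proof (rule iffI)
  assume e: "D \<inter> cball c r = {}"
  have pos: "0 < dist c y - r" if "y \<in> D" for y
    using e that by auto
  obtain \<delta> where \<delta>: "\<delta> > 0" "\<And>y. y \<in> D \<Longrightarrow> r + \<delta> \<le> dist c y"
  proof (cases "D = {}")
    case False
    show ?thesis
    proof (rule that[of "Min ((\<lambda>y. dist c y - r) ` D)"])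
      show "0 < Min ((\<lambda>y. dist c y - r) ` D)" using D False pos by (subst Min_gr_iff) auto
      fix y assume "y \<in> D"
      then have "Min ((\<lambda>y. dist c y - r) ` D) \<le> dist c y - r" using D by (intro Min_le) auto
      then show "r + Min ((\<lambda>y. dist c y - r) ` D) \<le> dist c y" by simp
    qed
  qed (use that[of 1] in auto)
  \<comment> \<open>The gap is spent twice: on the distance from \<open>q k\<close> to
    \<open>c\<close> and on the enlarged radius.\<close>
  obtain m :: nat where m: "1 / real (Suc m) < \<delta> / 2"
    using reals_Archimedean[of "\<delta> / 2"] \<delta>(1) by (auto simp: inverse_eq_divide)
  have False if "dist (q k) c < 1 / real (Suc m)" "y \<in> D" "dist (q k) y < r + 1 / real (Suc m)" for k y
  proof -
    have "dist c y \<le> dist (q k) c + dist (q k) y" by (metis dist_commute dist_triangle)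
    with that m \<delta>(2)[OF that(2)] show False by linarith
  qed
  then show "\<not> (\<forall>m::nat. \<exists>k. dist (q k) c < 1 / real (Suc m) \<and> D \<inter> ball (q k) (r + 1 / real (Suc m)) \<noteq> {})"
    by (auto simp: ball_def intro!: exI[of _ m])
next
  assume a: "\<not> (\<forall>m::nat. \<exists>k. dist (q k) c < 1 / real (Suc m) \<and> D \<inter> ball (q k) (r + 1 / real (Suc m)) \<noteq> {})"
  show "D \<inter> cball c r = {}"
  proof (rule ccontr)
    assume "D \<inter> cball c r \<noteq> {}"
    then obtain y where y: "y \<in> D" "dist c y \<le> r" by auto
    have "\<exists>k. dist (q k) c < 1 / real (Suc m) \<and> D \<inter> ball (q k) (r + 1 / real (Suc m)) \<noteq> {}" for m
    proof -
      obtain k where k: "q k \<in> ball c (1 / real (Suc m))"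
        using Q[of "ball c (1 / real (Suc m))"] by auto
      have "dist (q k) y \<le> dist c (q k) + dist c y" by (metis dist_commute dist_triangle)
      then have "y \<in> D \<inter> ball (q k) (r + 1 / real (Suc m))" using k y by auto
      then show ?thesis using k by (auto simp: dist_commute intro!: exI[of _ k])
    qed
    with a show False by blast
  qed
qed

lemma ex_dense_sequence:
  "\<exists>q :: nat \<Rightarrow> 'a::second_countable_topology. \<forall>X. open X \<and> X \<noteq> {} \<longrightarrow> (\<exists>k. q k \<in> X)"
proof -
  obtain Q :: "'a set" where Q: "countable Q" "\<And>X. open X \<Longrightarrow> X \<noteq> {} \<Longrightarrow> \<exists>d\<in>Q. d \<in> X"
    using countable_dense_exists by blast
  have "\<exists>k. from_nat_into Q k \<in> X" if "open X" "X \<noteq> {}" for X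
    using Q(2)[OF that] from_nat_into_surj[OF Q(1)] by metis
  then show ?thesis by blast
qed

text \<open>The volume is the measure of a section of a measurable set in the product space, so it
  depends measurably on \<open>x\<close>. The pairs are written out to present the integrand as a
  function on the product.\<close>

lemma borel_measurable_lens_vol [measurable]:
  "(lens_vol r rd :: real^'n \<Rightarrow> real) \<in> borel_measurable borel"
proof -
  have "lens_vol r rd = (\<lambda>x::real^'n. enn2real (\<integral>\<^sup>+y. indicator {z. norm z < rd \<and> norm (fst (x, z) + snd (x, z)) \<le> r} y \<partial>lborel))"
  proof
    fix x :: "real^'n"
    have "{z. norm z < rd \<and> norm (fst (x, z) + snd (x, z)) \<le> r} = ball 0 rd \<inter> cball (- x) r"
      by (auto simp: dist_norm norm_minus_commute[of "- x"] add.commute)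
    moreover have "ball 0 rd \<inter> cball (- x) r \<in> sets lborel" by simp
    ultimately show "lens_vol r rd x = enn2real (\<integral>\<^sup>+y. indicator {z. norm z < rd \<and> norm (fst (x, z) + snd (x, z)) \<le> r} y \<partial>lborel)"
      by (simp add: lens_vol_def measure_def)
  qed
  also have "\<dots> \<in> borel_measurable borel"
    by measurable
  finally show ?thesis .
qed

text \<open>\<open>card\<close> is \<open>0\<close> on infinite sets as well; local finiteness rules
  this out.\<close>

lemma pcount_eq_0_iff:
  assumes "poisson_pp M P lam S" "w \<in> space M" "bounded A"
  shows "pcount P A w = 0 \<longleftrightarrow> P w \<inter> A = {}"
  using assms by (auto simp: poisson_pp_def pcount_def)

lemma pp_sigma_void:
  fixes P :: "'w \<Rightarrow> 'a::euclidean_space set"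
  assumes P: "poisson_pp M P lam S" and A: "A \<in> sets borel" "bounded A"
  shows "{w \<in> space M. P w \<inter> A = {}} \<in> pp_sigma M P"
proof -
  have "{w \<in> space M. pcount P A w = 0} \<in> pp_sigma M P"
    unfolding pp_sigma_def using A by (intro sigma_sets.Basic) auto
  moreover have "{w \<in> space M. pcount P A w = 0} = {w \<in> space M. P w \<inter> A = {}}"
    using pcount_eq_0_iff[OF P _ A(2)] by auto
  ultimately show ?thesis by simp
qed

lemma poisson_pp_void_prob:
  fixes P :: "'w \<Rightarrow> 'a::euclidean_space set"
  assumes P: "poisson_pp M P lam S" and A: "A \<in> sets borel" "bounded A"
  shows "measure M {w \<in> space M. P w \<inter> A = {}} = exp (- (lam * measure lborel (A \<inter> S)))"
proof -
  have "{w \<in> space M. pcount P A w = 0} = {w \<in> space M. P w \<inter> A = {}}"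
    using pcount_eq_0_iff[OF P _ A(2)] by auto
  moreover have "measure M {w \<in> space M. pcount P A w = 0} = exp (- (lam * measure lborel (A \<inter> S)))"
    using P A unfolding poisson_pp_def by simp
  ultimately show ?thesis by simp
qed

lemma Int_stable_sigma_sets:
  assumes "G \<subseteq> Pow S"
  shows "Int_stable (sigma_sets S G)"
proof -
  interpret sigma_algebra S "sigma_sets S G"
    by (rule sigma_algebra_sigma_sets[OF assms])
  show ?thesis unfolding Int_stable_def by blast
qed

section \<open>Conditioning on the parents, and the law of the contact distance\<close>

context
  fixes M :: "'w measure" and X :: "nat \<Rightarrow> 'w \<Rightarrow> real^'n" and D :: "nat \<Rightarrow> 'w \<Rightarrow> (real^'n) set"
    and lp ld rd :: real
  assumes matern: "matern_cluster M X D lp ld rd"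
begin

interpretation prob_space M
  using matern by (simp add: matern_cluster_def)

lemma parents: "X i \<in> borel_measurable M" "w \<in> space M \<Longrightarrow> inj (\<lambda>i. X i w)"
    "poisson_pp M (\<lambda>w. range (\<lambda>i. X i w)) lp UNIV"
  and daughters: "poisson_pp M (D i) ld (ball 0 rd)"
  using matern by (auto simp: matern_cluster_def)

abbreviation parent_sigma :: "'w set set" where
  "parent_sigma \<equiv> sigma_sets (space M) (\<Union>i. {X i -` B \<inter> space M | B. B \<in> sets borel})"

abbreviation source_sigma :: "nat option \<Rightarrow> 'w set set" where
  "source_sigma \<equiv> (\<lambda>j. case j of None \<Rightarrow> parent_sigma | Some i \<Rightarrow> pp_sigma M (D i))"

lemma indep_sources: "indep_sets source_sigma UNIV"
  using matern by (simp add: matern_cluster_def)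

text \<open>Supplies a sub-sigma-algebra on the sample space of \<open>M\<close>; the probability is
  put on it by \<open>distr M\<close> along the identity. The same holds for
  \<open>daughter_space\<close>.\<close>

definition parent_space :: "'w measure" where
  "parent_space = sigma (space M) (source_sigma None)"

definition daughter_space :: "'w measure" where
  "daughter_space = sigma (space M) (\<Union>i. source_sigma (Some i))"

lemma source_sigma_Pow: "source_sigma j \<subseteq> Pow (space M)"
  using indep_sources sets.space_closed unfolding indep_sets_def by blast

lemma space_parent_space [simp]: "space parent_space = space M"
  and space_daughter_space [simp]: "space daughter_space = space M"
  by (simp_all add: parent_space_def daughter_space_def space_measure_of_conv)

lemma sets_parent_space: "sets parent_space = sigma_sets (space M) (source_sigma None)"
  unfolding parent_space_def using source_sigma_Pow[of None] by (rule sets_measure_of)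

lemma sets_daughter_space: "sets daughter_space = sigma_sets (space M) (\<Union>i. source_sigma (Some i))"
  unfolding daughter_space_def using source_sigma_Pow by (intro sets_measure_of) blast

lemma measurable_parent: "X i \<in> borel_measurable parent_space"
proof (rule measurableI)
  fix B :: "(real^'n) set" assume "B \<in> sets borel"
  then have "X i -` B \<inter> space M \<in> source_sigma None"
    by (auto intro!: sigma_sets.Basic)
  then show "X i -` B \<inter> space parent_space \<in> sets parent_space"
    unfolding sets_parent_space by (auto intro: sigma_sets.Basic)
qed simp

lemma pp_sigma_daughter_space:
  assumes "A \<in> pp_sigma M (D i)"
  shows "A \<in> sets daughter_space"
  unfolding sets_daughter_space using assms by (intro sigma_sets.Basic) force

lemma Int_stable_source_sigma: "Int_stable (source_sigma j)"
proof (cases j)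
  case None
  then show ?thesis by (auto intro: Int_stable_sigma_sets)
next
  case (Some i)
  then show ?thesis by (auto simp: pp_sigma_def intro!: Int_stable_sigma_sets)
qed

text \<open>With identity maps into the two sub-sigma-algebras, independence makes the law of \<open>(w, w)\<close> a
  product measure, so that Fubini replaces conditioning on the parents.\<close>
lemma indep_parent_daughter:
  "indep_var parent_space (\<lambda>w. w) daughter_space (\<lambda>w. w)"
proof -
  let ?I = "case_bool {None} (range Some) :: bool \<Rightarrow> nat option set"
  have U: "(\<Union>j\<in>UNIV. ?I j) = UNIV"
    by (auto simp: UNIV_bool split: bool.splits intro: option.exhaust)
  have "indep_sets (\<lambda>j. sigma_sets (space M) (\<Union>i\<in>?I j. source_sigma i)) UNIV"
    using indep_sources U
    by (intro indep_sets_collect_sigma Int_stable_source_sigma)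
       (auto simp: disjoint_family_on_def split: bool.splits)
  also have "(\<lambda>j. sigma_sets (space M) (\<Union>i\<in>?I j. source_sigma i))
      = case_bool (sets parent_space) (sets daughter_space)"
    by (rule ext) (auto simp: sets_parent_space sets_daughter_space split: bool.splits)
  finally have ind: "indep_set (sets parent_space) (sets daughter_space)"
    unfolding indep_set_def .
  have sub: "sets parent_space \<subseteq> events" "sets daughter_space \<subseteq> events"
    using ind by (auto simp: indep_sets2_eq)
  have id: "sigma_sets (space M) {(\<lambda>w. w) -` A \<inter> space M |A. A \<in> sets N} = sets N"
    if "space N = space M" for N
  proof -
    have "{(\<lambda>w. w) -` A \<inter> space M |A. A \<in> sets N} = sets N"
      using sets.sets_into_space[of _ N] that by auto (metis inf.absorb1)
    then show ?thesis using sets.sigma_sets_eq[of N] that by simp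
  qed
  have "(\<lambda>w. w) \<in> measurable M N" if "space N = space M" "sets N \<subseteq> events" for N
  proof (rule measurableI)
    fix A assume "A \<in> sets N"
    then show "(\<lambda>w. w) -` A \<inter> space M \<in> events"
      using that by (auto simp: vimage_ident intro: sets.Int)
  qed (simp add: that)
  then have "(\<lambda>w. w) \<in> measurable M parent_space" "(\<lambda>w. w) \<in> measurable M daughter_space"
    using sub by auto
  then show ?thesis
    unfolding indep_var_eq id[OF space_parent_space] id[OF space_daughter_space]
    using ind by simp
qed

abbreviation void_event :: "real \<Rightarrow> 'w set" where
  "void_event r \<equiv> {w \<in> space M. \<forall>i. D i w \<inter> cball (- X i w) r = {}}"

lemma daughters_finite: "w \<in> space M \<Longrightarrow> finite (D i w)"
  "w \<in> space M \<Longrightarrow> D i w \<subseteq> ball 0 rd"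
proof -
  assume w: "w \<in> space M"
  show "D i w \<subseteq> ball 0 rd" using w daughters[of i] by (auto simp: poisson_pp_def)
  then have "D i w \<inter> ball 0 rd = D i w" by auto
  then show "finite (D i w)"
    using w daughters[of i] bounded_ball[of 0 rd] unfolding poisson_pp_def by metis
qed

text \<open>The first component carries the parents and the second the daughters. By
  \<open>finite_disjoint_cball_iff\<close> the condition is built from countably many events, each
  about either the distance from \<open>- X i\<close> to a fixed \<open>q k\<close> or one daughter
  process in a fixed ball, and each measurable in its own component.\<close>

lemma void_set_measurable:
  "{p \<in> space (parent_space \<Otimes>\<^sub>M daughter_space). \<forall>i. D i (snd p) \<inter> cball (- X i (fst p)) r = {}}
    \<in> sets (parent_space \<Otimes>\<^sub>M daughter_space)"
proof -
  obtain q :: "nat \<Rightarrow> real^'n" where q: "\<And>X. open X \<Longrightarrow> X \<noteq> {} \<Longrightarrow> \<exists>k. q k \<in> X"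
    using ex_dense_sequence[where 'a = "real^'n"] by blast
  note measurable_parent [measurable]
  have [measurable]: "Measurable.pred daughter_space (\<lambda>w. D i w \<inter> ball c s = {})" for i c s
    using pp_sigma_void[OF daughters, of "ball c s" i]
    by (simp add: pred_def pp_sigma_daughter_space)
  have "{p \<in> space (parent_space \<Otimes>\<^sub>M daughter_space). \<forall>i. D i (snd p) \<inter> cball (- X i (fst p)) r = {}} =
    {p \<in> space (parent_space \<Otimes>\<^sub>M daughter_space). \<forall>i. \<not> (\<forall>m::nat. \<exists>k::nat.
        dist (q k) (- X i (fst p)) < 1 / real (Suc m) \<and> \<not> D i (snd p) \<inter> ball (q k) (r + 1 / real (Suc m)) = {})}"
    using finite_disjoint_cball_iff[OF daughters_finite(1) q]
    by (intro Collect_cong conj_cong refl all_cong1) (simp add: space_pair_measure mem_Times_iff)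
  also have "\<dots> \<in> sets (parent_space \<Otimes>\<^sub>M daughter_space)"
    by measurable
  finally show ?thesis .
qed

text \<open>The parents are frozen at \<open>w\<close> and only the daughters vary with
  \<open>w'\<close>. Clusters of parents at distance \<open>r + rd\<close> or more never reach the
  ball, finitely many parents remain, and their daughters are independent. Injectivity of the
  enumeration turns the product over indices into one over points.\<close>

lemma void_prob_given_parents:
  assumes w: "w \<in> space M"
  shows "prob {w' \<in> space M. \<forall>i. D i w' \<inter> cball (- X i w) r = {}}
    = (\<Prod>x\<in>range (\<lambda>i. X i w) \<inter> ball 0 (r + rd). exp (- (ld * lens_vol r rd x)))"
proof -
  define I where "I = {i. X i w \<in> ball 0 (r + rd)}"
  have inj: "inj_on (\<lambda>i. X i w) I" using parents(2)[OF w] by (rule inj_on_subset) simp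
  have img: "(\<lambda>i. X i w) ` I = range (\<lambda>i. X i w) \<inter> ball 0 (r + rd)" by (auto simp: I_def)
  have "finite ((\<lambda>i. X i w) ` I)"
    unfolding img using parents(3) w bounded_ball unfolding poisson_pp_def by blast
  then have I: "finite I" using inj by (rule finite_imageD)
  have far: "D i w' \<inter> cball (- X i w) r = {}" if "i \<notin> I" "w' \<in> space M" for i w'
  proof -
    have False if y: "y \<in> D i w'" "y \<in> cball (- X i w) r" for y
    proof -
      have "norm y < rd" using daughters_finite(2)[OF \<open>w' \<in> space M\<close>, of i] y by auto
      moreover have "norm (X i w + y) \<le> r"
        using y by (simp add: dist_norm norm_minus_commute[of "- X i w"] add.commute)
      moreover have "norm (X i w) \<le> norm (X i w + y) + norm y" by norm
      ultimately show False using \<open>i \<notin> I\<close> by (simp add: I_def)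
    qed
    then show ?thesis by blast
  qed
  define A where "A j = {w' \<in> space M. D (the j) w' \<inter> cball (- X (the j) w) r = {}}" for j
  have "prob {w' \<in> space M. \<forall>i. D i w' \<inter> cball (- X i w) r = {}} = (\<Prod>j\<in>Some ` I. prob (A j))"
  \<comment> \<open>The intersection over an empty index set would be the whole type instead of
    \<open>space M\<close>, and the product rule for independent sets asks for a nonempty
    one.\<close>
  proof (cases "I = {}")
    case True
    then have "{w' \<in> space M. \<forall>i. D i w' \<inter> cball (- X i w) r = {}} = space M" using far by auto
    then show ?thesis using True by (simp add: prob_space)
  next
    case False
    have "{w' \<in> space M. \<forall>i. D i w' \<inter> cball (- X i w) r = {}} = (\<Inter>j\<in>Some ` I. A j)"
      using False far by (auto simp: A_def)
    moreover have "A j \<in> source_sigma j" if "j \<in> Some ` I" for j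
      using that pp_sigma_void[OF daughters, of "cball (- X (the j) w) r" "the j"] by (auto simp: A_def)
    then have "prob (\<Inter>j\<in>Some ` I. A j) = (\<Prod>j\<in>Some ` I. prob (A j))"
      using False I by (intro indep_setsD[OF indep_sources]) auto
    ultimately show ?thesis by simp
  qed
  also have "\<dots> = (\<Prod>i\<in>I. exp (- (ld * lens_vol r rd (X i w))))"
    by (simp add: prod.reindex A_def poisson_pp_void_prob[OF daughters] lens_vol_def Int_commute)
  also have "\<dots> = (\<Prod>x\<in>range (\<lambda>i. X i w) \<inter> ball 0 (r + rd). exp (- (ld * lens_vol r rd x)))"
    unfolding img[symmetric] by (simp add: prod.reindex[OF inj])
  finally show ?thesis .
qed

text \<open>The event is the preimage of the set in \<open>void_set_measurable\<close> under the
  diagonal map. Its section at fixed parents has the probability computed in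
  \<open>void_prob_given_parents\<close>, a product over parent points whose expectation is the
  product functional of the Poisson process.\<close>

lemma void_event_measurable: "void_event r \<in> events"
  and void_event_prob:
  "lp \<ge> 0 \<Longrightarrow> ld \<ge> 0 \<Longrightarrow> prob (void_event r)
    = exp (- lp * (\<integral>x. indicator (ball 0 (r + rd)) x * (1 - exp (- (ld * lens_vol r rd (x::real^'n)))) \<partial>lborel))"
proof -
  let ?S = "{p \<in> space (parent_space \<Otimes>\<^sub>M daughter_space). \<forall>i. D i (snd p) \<inter> cball (- X i (fst p)) r = {}}"
  have rv [measurable]: "(\<lambda>w. w) \<in> measurable M parent_space" "(\<lambda>w. w) \<in> measurable M daughter_space"
    and joint: "distr M parent_space (\<lambda>w. w) \<Otimes>\<^sub>M distr M daughter_space (\<lambda>w. w)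
      = distr M (parent_space \<Otimes>\<^sub>M daughter_space) (\<lambda>w. (w, w))"
    using indep_parent_daughter unfolding indep_var_distribution_eq by auto
  note S = void_set_measurable[of r]
  have pre: "(\<lambda>w. (w, w)) -` ?S \<inter> space M = void_event r"
    by (auto simp: space_pair_measure)
  have "(\<lambda>w. (w, w)) \<in> measurable M (parent_space \<Otimes>\<^sub>M daughter_space)" by measurable
  from measurable_sets[OF this S] show "void_event r \<in> events" unfolding pre .
  interpret D: prob_space "distr M daughter_space (\<lambda>w. w)"
    by (rule prob_space_distr) (rule rv)
  assume nn: "lp \<ge> 0" "ld \<ge> 0"
  have "emeasure M (void_event r) = emeasure (distr M (parent_space \<Otimes>\<^sub>M daughter_space) (\<lambda>w. (w, w))) ?S"
    by (subst emeasure_distr[OF _ S]) (measurable, simp only: pre)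
  also have "\<dots> = (\<integral>\<^sup>+w. emeasure (distr M daughter_space (\<lambda>w. w)) (Pair w -` ?S) \<partial>distr M parent_space (\<lambda>w. w))"
    unfolding joint[symmetric] using S by (intro D.emeasure_pair_measure_alt) simp
  also have "\<dots> = (\<integral>\<^sup>+w. emeasure (distr M daughter_space (\<lambda>w. w)) (Pair w -` ?S) \<partial>M)"
    using S by (intro nn_integral_distr rv D.measurable_emeasure_Pair) simp
  also have "\<dots> = (\<integral>\<^sup>+w. ennreal (\<Prod>x\<in>range (\<lambda>i. X i w) \<inter> ball 0 (r + rd). exp (- (ld * lens_vol r rd x))) \<partial>M)"
  proof (rule nn_integral_cong)
    fix w assume w: "w \<in> space M"
    have "emeasure (distr M daughter_space (\<lambda>w. w)) (Pair w -` ?S) = emeasure M (Pair w -` ?S \<inter> space M)"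
      using sets_Pair1[OF S, of w] by (subst emeasure_distr) auto
    also have "Pair w -` ?S \<inter> space M = {w' \<in> space M. \<forall>i. D i w' \<inter> cball (- X i w) r = {}}"
      using w by (auto simp: space_pair_measure)
    finally show "emeasure (distr M daughter_space (\<lambda>w. w)) (Pair w -` ?S) =
      ennreal (\<Prod>x\<in>range (\<lambda>i. X i w) \<inter> ball 0 (r + rd). exp (- (ld * lens_vol r rd x)))"
      by (simp add: emeasure_eq_measure void_prob_given_parents[OF w])
  qed
  also have "\<dots> = ennreal (exp (- lp * (\<integral>x. indicator (ball 0 (r + rd)) x * (1 - exp (- (ld * lens_vol r rd (x::real^'n)))) \<partial>lborel)))"
  proof -
    have "lens_vol r rd x \<ge> 0" for x :: "real^'n" by (simp add: lens_vol_def)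
    then show ?thesis
      using nn poisson_pp_product_functional[OF prob_space_axioms parents(3) nn(1), of "ball 0 (r + rd)"
          "\<lambda>x. exp (- (ld * lens_vol r rd x))"]
      by (auto simp: has_bochner_integral_iff nn_integral_eq_integral prod_nonneg)
  qed
  finally show "prob (void_event r)
    = exp (- lp * (\<integral>x. indicator (ball 0 (r + rd)) x * (1 - exp (- (ld * lens_vol r rd (x::real^'n)))) \<partial>lborel))"
    by (simp add: emeasure_eq_measure)
qed

text \<open>Without cluster points every daughter process is empty. There are infinitely many of
  them, independent, each empty with the same probability \<open>p < 1\<close>. The event needs
  attention because \<open>contact_dist\<close> is then the infimum of an empty set.\<close>

lemma cluster_points_empty_null:
  assumes "ld > 0" "rd > 0"
  shows "{w \<in> space M. cluster_points X D w = {}} \<in> null_sets M"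
proof -
  define A where "A j = {w \<in> space M. D (the j) w \<inter> ball 0 rd = {}}" for j :: "nat option"
  have A: "A (Some i) \<in> source_sigma (Some i)" for i
    using pp_sigma_void[OF daughters, of "ball 0 rd" i] by (simp add: A_def)
  have A_ev: "A (Some i) \<in> events" for i
    using A[of i] indep_sources unfolding indep_sets_def by blast
  define p where "p = exp (- (ld * measure lborel (ball (0::real^'n) rd)))"
  have pA: "prob (A (Some i)) = p" for i
    by (simp add: A_def p_def poisson_pp_void_prob[OF daughters])
  have p: "0 \<le> p" "p < 1" using assms content_ball_pos[of rd "0::real^'n"] by (simp_all add: p_def)
  define Z where "Z = (\<Inter>i. A (Some i))"
  have eq: "{w \<in> space M. cluster_points X D w = {}} = Z"
    using daughters_finite(2) by (fastforce simp: Z_def A_def cluster_points_def)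
  have Z: "Z \<in> events" unfolding Z_def using A_ev by (intro sets.countable_INT) auto
  have "prob Z \<le> p ^ Suc N" for N
  proof -
    have "prob Z \<le> prob (\<Inter>j\<in>Some ` {..N}. A j)"
      using A_ev by (intro finite_measure_mono sets.finite_INT) (auto simp: Z_def)
    also have "\<dots> = (\<Prod>j\<in>Some ` {..N}. prob (A j))"
      using A by (intro indep_setsD[OF indep_sources]) auto
    also have "\<dots> = p ^ Suc N" by (simp add: prod.reindex pA)
    finally show ?thesis .
  qed
  moreover have "(\<lambda>N. p ^ Suc N) \<longlonglongrightarrow> 0"
    using p by (intro LIMSEQ_Suc LIMSEQ_realpow_zero) auto
  ultimately have "prob Z \<le> 0" by (intro LIMSEQ_le_const) auto
  then have "prob Z = 0" by (intro antisym measure_nonneg)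
  then show ?thesis using Z by (simp add: eq null_sets_def emeasure_eq_measure)
qed

text \<open>Only finitely many cluster points lie within \<open>r + 1\<close> of the origin, so if
  none lies within \<open>r\<close>, all norms stay above some \<open>m > r\<close>, and so does the
  infimum.\<close>

lemma contact_dist_le_iff:
  assumes w: "w \<in> space M" and ne: "cluster_points X D w \<noteq> {}"
  shows "contact_dist X D w \<le> r \<longleftrightarrow> w \<notin> void_event r"
proof -
  let ?C = "cluster_points X D w"
  have mem: "y \<in> D i w \<inter> cball (- X i w) r \<longleftrightarrow> y \<in> D i w \<and> norm (X i w + y) \<le> r" for y i
    by (auto simp: dist_norm norm_minus_commute[of "- X i w"] add.commute)
  have void: "w \<notin> void_event r \<longleftrightarrow> (\<exists>z\<in>?C. norm z \<le> r)"
    using w mem unfolding cluster_points_def by blast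
  have bdd: "bdd_below (norm ` ?C)" by (rule bdd_belowI2[of _ 0]) simp
  show ?thesis unfolding void
  proof
    assume "\<exists>z\<in>?C. norm z \<le> r"
    then show "contact_dist X D w \<le> r"
      unfolding contact_dist_def using bdd by (auto intro: cINF_lower2)
  next
    assume le: "contact_dist X D w \<le> r"
    let ?K = "{z \<in> ?C. norm z \<le> r + 1}"
    define I where "I = {i. X i w \<in> cball 0 (r + 1 + rd)}"
    have "inj_on (\<lambda>i. X i w) I" using parents(2)[OF w] by (rule inj_on_subset) simp
    moreover have "(\<lambda>i. X i w) ` I = range (\<lambda>i. X i w) \<inter> cball 0 (r + 1 + rd)" by (auto simp: I_def)
    then have "finite ((\<lambda>i. X i w) ` I)"
      using parents(3) w bounded_cball[of 0 "r + 1 + rd"] unfolding poisson_pp_def by metis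
    ultimately have "finite I" by (metis finite_imageD)
    have "?K \<subseteq> (\<Union>i\<in>I. (\<lambda>z. X i w + z) ` D i w)"
    proof
      fix z assume "z \<in> ?K"
      then obtain i y where y: "y \<in> D i w" "z = X i w + y" "norm z \<le> r + 1"
        unfolding cluster_points_def by auto
      have "norm y < rd" using daughters_finite(2)[OF w, of i] y by auto
      moreover have "norm (X i w) \<le> norm (X i w + y) + norm y" by norm
      ultimately have "i \<in> I" using y by (simp add: I_def)
      then show "z \<in> (\<Union>i\<in>I. (\<lambda>z. X i w + z) ` D i w)" using y by auto
    qed
    then have K: "finite ?K"
      using \<open>finite I\<close> daughters_finite(1)[OF w] by (auto intro: finite_subset)
    show "\<exists>z\<in>?C. norm z \<le> r"
    proof (rule ccontr)
      assume far: "\<not> (\<exists>z\<in>?C. norm z \<le> r)"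
      \<comment> \<open>Inserting \<open>r + 1\<close> covers the points outside \<open>?K\<close>
        and keeps the minimum defined when \<open>?K\<close> is empty.\<close>
      define m where "m = Min (insert (r + 1) (norm ` ?K))"
      have "r < m" unfolding m_def using K far by (subst Min_gr_iff) auto
      moreover have "m \<le> norm z" if "z \<in> ?C" for z
      proof (cases "norm z \<le> r + 1")
        case True
        then show ?thesis unfolding m_def using K that by (intro Min_le) auto
      next
        case False
        moreover have "m \<le> r + 1" unfolding m_def using K by (intro Min_le) auto
        ultimately show ?thesis by simp
      qed
      then have "m \<le> contact_dist X D w"
        unfolding contact_dist_def using ne by (intro cINF_greatest) auto
      ultimately show False using le by simp
    qed
  qed
qed

lemma contact_dist_prob:
  assumes "lp \<ge> 0" "ld > 0" "rd > 0"
  shows "prob {w \<in> space M. contact_dist X D w \<le> r} = 1 - exp (- lp *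
    (\<integral>x. indicator (ball 0 (r + rd)) x * (1 - exp (- (ld * lens_vol r rd (x::real^'n)))) \<partial>lborel))"
proof -
  let ?Z = "{w \<in> space M. cluster_points X D w = {}}"
  text \<open>On \<open>?Z\<close> the contact distance is the unspecified value \<open>Inf {}\<close>, hence the case distinction
    below.\<close>
  have Z: "?Z \<in> null_sets M" using assms by (intro cluster_points_empty_null)
  have ZV: "?Z \<subseteq> void_event r" by (auto simp: cluster_points_def)
  have "{w \<in> space M. contact_dist X D w \<le> r}
      = (space M - void_event r) \<union> (if Inf ({}::real set) \<le> r then ?Z else {})"
  proof (rule set_eqI)
    fix w
    show "w \<in> {w \<in> space M. contact_dist X D w \<le> r} \<longleftrightarrow>
      w \<in> (space M - void_event r) \<union> (if Inf ({}::real set) \<le> r then ?Z else {})"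
    proof (cases "w \<in> ?Z")
      case True
      then have "contact_dist X D w = Inf {}" "w \<in> space M" "w \<in> void_event r"
        using ZV by (auto simp: contact_dist_def)
      then show ?thesis using True by simp
    next
      case False
      then show ?thesis using contact_dist_le_iff[of w r] by auto
    qed
  qed
  moreover have "(if Inf ({}::real set) \<le> r then ?Z else {}) \<in> null_sets M"
    using Z by simp
  ultimately have "prob {w \<in> space M. contact_dist X D w \<le> r} = prob (space M - void_event r)"
    using void_event_measurable[of r] by (simp add: measure_Un_null_set)
  then show ?thesis
    using assms void_event_measurable[of r] by (simp add: prob_compl void_event_prob)
qed

end

section \<open>The bounds\<close>

text \<open>The constant \<open>1\<close> accounts for the term \<open>(r + rd) ^ n\<close> of both
  bounds; what remains to be estimated is the integral of \<open>g\<close>.\<close>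

lemma integral_ball_one_minus:
  fixes g :: "real^'n \<Rightarrow> real"
  assumes R: "R \<ge> 0" and g: "g \<in> borel_measurable borel" "\<And>x. 0 \<le> g x" "\<And>x. g x \<le> 1"
  shows "integrable lborel (\<lambda>x. indicator (ball 0 R) x * g x)"
    and "(\<integral>x. indicator (ball 0 R) x * (1 - g x) \<partial>lborel) =
      unit_ball_volume TYPE('n) * R ^ CARD('n) - (\<integral>x. indicator (ball 0 R) x * g x \<partial>lborel)"
proof -
  note [measurable] = g(1)
  have [measurable]: "ball (0::real^'n) R \<in> sets borel" by simp
  have b: "integrable lborel (indicator (ball (0::real^'n) R) :: _ \<Rightarrow> real)"
    using emeasure_lborel_ball_finite[of "0::real^'n" R] by (intro integrable_real_indicator) auto
  show i: "integrable lborel (\<lambda>x. indicator (ball 0 R) x * g x)"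
    by (rule Bochner_Integration.integrable_bound[OF b])
      (measurable, use g in \<open>auto simp: indicator_def\<close>)
  have "(\<integral>x. indicator (ball 0 R) x * (1 - g x) \<partial>lborel)
      = (\<integral>x. indicator (ball 0 R) x - indicator (ball 0 R) x * g x \<partial>lborel)"
    by (simp add: right_diff_distrib)
  also have "\<dots> = (\<integral>x. indicator (ball (0::real^'n) R) x \<partial>lborel) - (\<integral>x. indicator (ball 0 R) x * g x \<partial>lborel)"
    by (rule Bochner_Integration.integral_diff[OF b i])
  finally show "(\<integral>x. indicator (ball 0 R) x * (1 - g x) \<partial>lborel) =
      unit_ball_volume TYPE('n) * R ^ CARD('n) - (\<integral>x. indicator (ball 0 R) x * g x \<partial>lborel)"
    using R by (simp add: measure_lborel_ball)
qed

theorem theorem2: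
  fixes M :: "'w measure"
    and X :: "nat \<Rightarrow> 'w \<Rightarrow> real^'n"
    and D :: "nat \<Rightarrow> 'w \<Rightarrow> (real^'n) set"
    and lp ld rd r :: real
  assumes "matern_cluster M X D lp ld rd"
    and "lp > 0" and "ld > 0" and "rd > 0" and "r > 0"
  defines "n \<equiv> CARD('n)"
    and "v \<equiv> unit_ball_volume TYPE('n)"
    and "\<beta> \<equiv> min r rd"
    and "F \<equiv> measure M {w \<in> space M. contact_dist X D w \<le> r}"
  shows
    "1 - exp (- (v * lp * ((r + rd) ^ n - \<bar>r - rd\<bar> ^ n * exp (- (ld * v * \<beta> ^ n))
        - (r + rd) ^ n * (\<Sum>i<n. real ((n - 1) choose i) * (-1) ^ i * 2 ^ (i + 1)
              * (ld * v * (r + rd) ^ n) powr (- (real (i + 1) / real n))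
              * lower_inc_gamma (real (i + 1) / real n) (ld * v * \<beta> ^ n)))))
     \<le> F
   \<and> F \<le>
     1 - exp (- (v * lp * ((r + rd) ^ n - \<bar>r - rd\<bar> ^ n * exp (- (ld * v * \<beta> ^ n))
        - fact n * (\<Sum>k<n. (-1) ^ (n - k - 1) / fact k
              * (ld * 2 ^ (n - 1) * \<beta> ^ (n - 1)) powi (int k - int n)
              * ((r + rd) ^ k - \<bar>r - rd\<bar> ^ k * exp (- (2 ^ n * ld * \<beta> ^ n)))))))"
proof -
  define R a where "R = r + rd" and "a = \<bar>r - rd\<bar>"
  define A where "A = exp (- (ld * v * \<beta> ^ n))"
  \<comment> \<open>Chosen so that \<open>c * (R - norm x)\<close> is \<open>ld\<close> times the
    volume of the box around the lens.\<close>
  define c where "c = ld * 2 ^ (n - 1) * \<beta> ^ (n - 1)"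
  define g where "g x = exp (- (ld * lens_vol r rd x))" for x :: "real^'n"
  \<comment> \<open>\<open>Iu\<close> and \<open>Il\<close> are named after the bounds on
    \<open>F\<close> to which they lead; for the integral of \<open>g\<close> over
    \<open>norm x \<ge> a\<close> the roles are reversed, \<open>Iu\<close> giving the lower and
    \<open>Il\<close> the upper estimate.\<close>
  define Iu where "Iu = fact n * (\<Sum>k<n. (-1) ^ (n - k - 1) / fact k * c powi (int k - int n)
      * (R ^ k - a ^ k * exp (- (c * (R - a)))))"
  define Il where "Il = R ^ n * (\<Sum>i<n. real ((n - 1) choose i) * (-1) ^ i * 2 ^ (i + 1)
      * (ld * v * R ^ n) powr (- (real (i + 1) / real n))
      * lower_inc_gamma (real (i + 1) / real n) (ld * v * ((R - a) / 2) ^ n))"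
  have n: "n > 0" by (simp add: n_def)
  have v: "v > 0" unfolding v_def by (rule unit_ball_volume_pos)
  have \<beta>: "\<beta> > 0" using assms by (simp add: \<beta>_def)
  have aR: "0 \<le> a" "a < R" "(R - a) / 2 = \<beta>" using assms by (auto simp: a_def R_def \<beta>_def min_def)
  have c: "c > 0" using assms(3) \<beta> by (simp add: c_def)
  have c2: "c * (R - a) = 2 ^ n * ld * \<beta> ^ n"
  proof -
    have "R - a = 2 * \<beta>" using aR by simp
    moreover have "2 ^ n = 2 * (2::real) ^ (n - 1)" "\<beta> ^ n = \<beta> * \<beta> ^ (n - 1)"
      using n by (simp_all add: power_eq_if)
    ultimately show ?thesis by (simp add: c_def)
  qed
  have "g \<in> borel_measurable borel" unfolding g_def by measurable
  moreover have "0 \<le> g x" "g x \<le> 1" for x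
    using assms(3) by (auto simp: g_def lens_vol_def)
  ultimately have g: "g \<in> borel_measurable borel" "\<And>x. 0 \<le> g x" "\<And>x. g x \<le> 1" .
  have F: "F = 1 - exp (- lp * (v * R ^ n - (\<integral>x. indicator (ball 0 R) x * g x \<partial>lborel)))"
    using contact_dist_prob[OF assms(1), of r] integral_ball_one_minus(2)[OF _ g, of R] assms(2-5)
    by (simp add: F_def R_def g_def v_def n_def)
  have "((\<lambda>s. real n * s ^ (n - 1) * exp (- (c * (R - s)))) has_integral Iu) {a..R}"
    unfolding Iu_def using aR by (intro has_integral_power_exp c n) auto
  then have up: "has_bochner_integral lborel (\<lambda>x::real^'n. indicator (ball 0 R) x *
      (if norm x < a then A else exp (- (c * (R - norm x))))) (v * (a ^ n * A + Iu))"
    unfolding n_def v_def using aR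
    by (intro has_bochner_integral_radial continuous_intros) auto
  have "((\<lambda>s. real n * s ^ (n - 1) * exp (- (ld * v * ((R - s) / 2) ^ n))) has_integral Il) {a..R}"
    unfolding Il_def using aR v assms(3) by (intro has_integral_power_exp_power n) auto
  then have lo: "has_bochner_integral lborel (\<lambda>x::real^'n. indicator (ball 0 R) x *
      (if norm x < a then A else exp (- (ld * v * ((R - norm x) / 2) ^ n)))) (v * (a ^ n * A + Il))"
    unfolding n_def v_def using aR
    by (intro has_bochner_integral_radial continuous_intros) auto
  have inside: "g x = A" if "norm x < a" for x
    using lens_vol_inside[of r rd x] that assms(4,5)
    by (simp add: g_def A_def a_def v_def n_def \<beta>_def mult.assoc)
  have upper: "exp (- (c * (R - norm x))) \<le> g x" if "a \<le> norm x" "norm x < R" for x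
  proof -
    have "lens_vol r rd x \<le> (R - norm x) * (2 * \<beta>) ^ (n - 1)"
      using lens_vol_le[of r rd x] that assms(4,5) by (simp add: a_def R_def n_def \<beta>_def)
    then have "ld * lens_vol r rd x \<le> ld * ((R - norm x) * (2 * \<beta>) ^ (n - 1))"
      using assms(3) by simp
    also have "\<dots> = c * (R - norm x)" by (simp add: c_def power_mult_distrib)
    finally show ?thesis by (simp add: g_def)
  qed
  have lower: "g x \<le> exp (- (ld * v * ((R - norm x) / 2) ^ n))" if "a \<le> norm x" "norm x < R" for x
  proof -
    have "v * ((R - norm x) / 2) ^ n \<le> lens_vol r rd x"
      using lens_vol_ge[of r rd x] that assms(4,5) by (simp add: a_def R_def n_def v_def)
    then have "ld * (v * ((R - norm x) / 2) ^ n) \<le> ld * lens_vol r rd x"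
      using assms(3) by simp
    then show ?thesis by (simp add: g_def mult.assoc)
  qed
  have gi: "integrable lborel (\<lambda>x. indicator (ball 0 R) x * g x)"
    using aR by (intro integral_ball_one_minus(1) g) auto
  have "v * (a ^ n * A + Iu) \<le> (\<integral>x. indicator (ball 0 R) x * g x \<partial>lborel)"
    using has_bochner_integral_integral_eq[OF up] integrable.intros[OF up] gi inside upper
    by (subst has_bochner_integral_integral_eq[OF up, symmetric], intro integral_mono)
      (auto simp: indicator_def)
  moreover have "(\<integral>x. indicator (ball 0 R) x * g x \<partial>lborel) \<le> v * (a ^ n * A + Il)"
    using integrable.intros[OF lo] gi inside lower
    by (subst has_bochner_integral_integral_eq[OF lo, symmetric], intro integral_mono)
      (auto simp: indicator_def)
  ultimately have "1 - exp (- (v * lp * (R ^ n - a ^ n * A - Il))) \<le> F"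
    and "F \<le> 1 - exp (- (v * lp * (R ^ n - a ^ n * A - Iu)))"
  proof -
    let ?G = "\<integral>x. indicator (ball 0 R) x * g x \<partial>lborel"
    assume "v * (a ^ n * A + Iu) \<le> ?G" "?G \<le> v * (a ^ n * A + Il)"
    then have "lp * (v * R ^ n - v * (a ^ n * A + Il)) \<le> lp * (v * R ^ n - ?G)"
      "lp * (v * R ^ n - ?G) \<le> lp * (v * R ^ n - v * (a ^ n * A + Iu))"
      using assms(2) by (intro mult_left_mono; simp)+
    then show "1 - exp (- (v * lp * (R ^ n - a ^ n * A - Il))) \<le> F"
      "F \<le> 1 - exp (- (v * lp * (R ^ n - a ^ n * A - Iu)))"
      unfolding F by (simp_all add: algebra_simps)
  qed
  then show ?thesis
    unfolding Il_def Iu_def aR(3) c2 unfolding A_def R_def a_def c_def by blast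
qed

end
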